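(* Let $s$ and $r$ be positive integers, $a\in\Bbbk-\{0\}$, and $f\in R^{\circ}_r(z)$ with $f=az^{-s/r}+\underline{o}(z^{-s/r})$. Then $$\mathcal{M}^{(0,\infty)}(E_f)\simeq D_g,$$ where $g\in S^{\circ}_{s}(\theta)$ is determined by the following system of equations: $$f=-\theta^{-1},$$ $$g=z-(-a)^{r/s}\left(\frac{r+s}{2s}\right)\theta^{1+(r/s)}.$$
   Context: $\Bbbk$ is an algebraically closed field of characteristic zero. The notation $\underline{o}(z^{k})$ denotes a series all of whose terms have order $>k$; for $f=\sum_{i\ge k}c_iz^{i/q}$ with $c_k\ne0$, $\mathrm{ord}(f)=k/q$ (similarly in other variables). **Connections.** Let $K=\Bbbk((z))$. Objects of $\mathcal{C}_0$ are pairs $(V,\nabla)$, $V$ a finite-dimensional $K$-vector space, $\nabla:V\to V$ a $\Bbbk$-linear map with $\nabla(hv)=h\nabla(v)+\frac{dh}{dz}v$ for $h\in K$; morphisms are $K$-linear maps commuting with the $\nabla$'s. For $q\ge1$ let $K_q=\Bbbk((z^{1/q}))$; for $f\in K_q$ set $E_f=(K_q,\frac{d}{dz}+z^{-1}f)$, viewed as an object over $K$. Let $R_q=R_q(z)$ be the set of orbits of $\mathrm{Gal}(K_q/K)$ (acting by $z^{1/q}\mapsto\eta z^{1/q}$, $\eta^q=1$) on $K_q/\left(z^{1/q}\Bbbk[[z^{1/q}]]+\frac{\mathbb{Z}}{q}\right)$, and let $R_q^\circ\subset R_q$ be the set of those classes that cannot be represented by elements of $K_{q'}$ for any $0<q'<q$.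 The isomorphism class of $E_f$ depends only on the class of $f$ in $R_q$, and $f\in R^\circ_q$ is identified with a representative in $K_q$. The objects $E_f$ with $f\in R_q^\circ$, $q\geq 1$, are exactly the irreducible objects of $\mathcal{C}_0$ up to isomorphism. $\mathcal{C}_0^{>0}$ is the full subcategory of $\mathcal{C}_0$ of objects whose irreducible components $E_f$ all have slope greater than zero, i.e. $\mathrm{ord}(f)<0$. **Difference operators.** Over $\Bbbk((\theta))$, let $\varphi$ be the $\Bbbk$-automorphism $\varphi(v(\theta))=v\left(\frac{\theta}{1+\theta}\right)$, extended to $\Bbbk((\theta^{1/q}))$ by $\varphi(v(\theta^{1/q}))=v\left(\theta^{1/q}\sum_{i\ge0}\binom{-1/q}{i}\theta^i\right)$. Objects of $\mathcal{N}$ are pairs $(V,\Phi)$, $V$ a finite-dimensional $\Bbbk((\theta))$-vector space and $\Phi:V\to V$ an invertible $\Bbbk$-linear map with $\Phi(hv)=\varphi(h)\Phi(v)$ for all $h\in\Bbbk((\theta))$; morphisms are $\Bbbk((\theta))$-linear maps commuting with the $\Phi$'s. For $g\in\Bbbk((\theta^{1/q}))^*$ set $D_g=(\Bbbk((\theta^{1/q})),g\varphi)$, viewed over $\Bbbk((\theta))$. Let $S_q=S_q(\theta)$ be the set of orbits of $\mathrm{Gal}(\Bbbk((\theta^{1/q}))/\Bbbk((\theta)))$ on the multiplicative quotient $\Bbbk((\theta^{1/q}))^*/\left(1+\frac{\mathbb{Z}}{q}\theta+\theta^{1+(1/q)}\Bbbk[[\theta^{1/q}]]\right)$, and $S_q^\circ\subset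 S_q$ the set of classes that cannot be represented by elements of $\Bbbk((\theta^{1/q'}))^*$ for any $0<q'<q$. The isomorphism class of $D_g$ depends only on the class of $g$ in $S_q$. **Local Mellin transform.** For $E=(V,\nabla)\in\mathcal{C}_0^{>0}$ put $\theta:=-(z\nabla)^{-1}:V\to V$ and $\Phi:=z:V\to V$. Then $\theta$ extends to an action of $\Bbbk((\theta))$ on $V$ (compatible with the topology: the $\theta$-adic topology on $V$ coincides with the $z$-adic topology), $V$ is finite-dimensional over $\Bbbk((\theta))$ (written $V_\theta$), $\Phi$ is an invertible difference operator, and $\mathcal{M}^{(0,\infty)}(E):=(V_\theta,\Phi)\in\mathcal{N}$. **How the system determines $g$.** In the system $z$ and $\theta$ are commuting formal variables. The equation $f=-\theta^{-1}$ is solved explicitly for $z$ as an element of $\Bbbk((\theta^{1/s}))$, with leading term $(-a)^{r/s}\theta^{r/s}$ (the symbol $(-a)^{r/s}$ in the second equation is this same leading coefficient); this is substituted into the second equation to give $g\in\Bbbk((\theta^{1/s}))$. Different choices of roots (replacing $\theta^{1/s}$ by $\eta\theta^{1/s}$, $\eta^s=1$) give the same Galois orbit. *)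

theory Defs
  imports
    "HOL-Computational_Algebra.Computational_Algebra"
begin

text \<open>
  An element of \<open>\<k>((z\<^sup>1\<^sup>/\<^sup>q))\<close> is represented by a formal Laurent series in the variable
  \<open>t = z\<^sup>1\<^sup>/\<^sup>q\<close>, so that \<open>z\<^sup>i\<^sup>/\<^sup>q\<close> is \<^term>\<open>fls_X_intpow i\<close>; the index \<open>q\<close> is carried separately.
  The inclusion of \<open>\<k>((z))\<close> is \<^term>\<open>\<lambda>h. fls_compose_power h q\<close>, i.e. \<open>h(z) = h(t\<^sup>q)\<close>.
\<close>

text \<open>
  \<open>f \<in> \<k>((z\<^sup>1\<^sup>/\<^sup>q))\<close> lies in \<open>\<k>((z\<^sup>1\<^sup>/\<^sup>p))\<close>: it agrees with some \<open>h\<close> in the latter field inside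
  the common overfield \<open>\<k>((z\<^sup>1\<^sup>/\<^sup>p\<^sup>q))\<close>.
\<close>

definition in_puiseux :: "nat \<Rightarrow> nat \<Rightarrow> 'k::field fls \<Rightarrow> bool" where
  "in_puiseux q p f \<longleftrightarrow> (\<exists>h. fls_compose_power f p = fls_compose_power h q)"

definition galois :: "'k::field \<Rightarrow> 'k fls \<Rightarrow> 'k fls" where
  "galois \<eta> f = fls_compose_fps f (fps_const \<eta> * fps_X)"


subsection \<open>The parameter sets\<close>

text \<open>
  An orbit of the Galois group on a quotient is represented by its preimage in \<open>\<k>((z\<^sup>1\<^sup>/\<^sup>q))\<close>,
  that is, by a class of the equivalence relation generated by the group action and the
  subgroup that is divided out.
\<close>

definition R_sub :: "nat \<Rightarrow> 'k::field_char_0 fls set" where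
  "R_sub q = {fls_X * fps_to_fls p + fls_const (of_int n / of_nat q) | p n. True}"

definition R_rel :: "nat \<Rightarrow> ('k::field_char_0 fls \<times> 'k fls) set" where
  "R_rel q = {(f, f'). \<exists>\<eta>. \<eta> ^ q = 1 \<and> f' - galois \<eta> f \<in> R_sub q}"

definition R :: "nat \<Rightarrow> 'k::field_char_0 fls set set" where
  "R q = UNIV // R_rel q"

definition R_circ :: "nat \<Rightarrow> 'k::field_char_0 fls set set" where
  "R_circ q = {C \<in> R q. \<forall>p. 0 < p \<and> p < q \<longrightarrow> \<not> (\<exists>f\<in>C. in_puiseux q p f)}"

definition S_sub :: "nat \<Rightarrow> 'k::field_char_0 fls set" where
  "S_sub q = {1 + fls_const (of_int n / of_nat q) * fls_X ^ q + fls_X ^ (q + 1) * fps_to_fls p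
              | p n. True}"

definition S_rel :: "nat \<Rightarrow> ('k::field_char_0 fls \<times> 'k fls) set" where
  "S_rel q = {(g, g'). g \<noteq> 0 \<and> g' \<noteq> 0 \<and> (\<exists>\<eta>. \<eta> ^ q = 1 \<and> g' / galois \<eta> g \<in> S_sub q)}"

definition S :: "nat \<Rightarrow> 'k::field_char_0 fls set set" where
  "S q = {g. g \<noteq> 0} // S_rel q"

definition S_circ :: "nat \<Rightarrow> 'k::field_char_0 fls set set" where
  "S_circ q = {C \<in> S q. \<forall>p. 0 < p \<and> p < q \<longrightarrow> \<not> (\<exists>g\<in>C. in_puiseux q p g)}"


subsection \<open>Connections and difference operators\<close>

text \<open>
  A vector space over \<open>\<k>((z))\<close> or \<open>\<k>((\<theta>))\<close>, whose underlying set is a whole type, with an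
  operator on it.
\<close>

record (overloaded) ('k::zero, 'v) op_space =
  scal :: "'k fls \<Rightarrow> 'v \<Rightarrow> 'v"
  oper :: "'v \<Rightarrow> 'v"

definition fin_dim_space :: "('k::field fls \<Rightarrow> 'v::ab_group_add \<Rightarrow> 'v) \<Rightarrow> bool" where
  "fin_dim_space sc \<longleftrightarrow> vector_space sc \<and> (\<exists>B. finite B \<and> module.span sc B = UNIV)"

definition k_linear :: "('k::field fls \<Rightarrow> 'v::ab_group_add \<Rightarrow> 'v) \<Rightarrow> ('v \<Rightarrow> 'v) \<Rightarrow> bool" where
  "k_linear sc L \<longleftrightarrow> Vector_Spaces.linear (\<lambda>c. sc (fls_const c)) (\<lambda>c. sc (fls_const c)) L"

definition connection :: "('k::field, 'v::ab_group_add) op_space \<Rightarrow> bool" where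
  "connection E \<longleftrightarrow> fin_dim_space (scal E) \<and> k_linear (scal E) (oper E) \<and>
     (\<forall>h v. oper E (scal E h v) = scal E h (oper E v) + scal E (fls_deriv h) v)"

text \<open>With \<open>t = z\<^sup>1\<^sup>/\<^sup>q\<close>, one has \<open>d/dz = (1/q) t\<^sup>1\<^sup>-\<^sup>q d/dt\<close>.\<close>

definition puiseux_deriv :: "nat \<Rightarrow> 'k::field_char_0 fls \<Rightarrow> 'k fls" where
  "puiseux_deriv q v = fls_const (1 / of_nat q) * fls_X_intpow (1 - int q) * fls_deriv v"

definition E_obj :: "nat \<Rightarrow> 'k::field_char_0 fls \<Rightarrow> ('k, 'k fls) op_space" where
  "E_obj q f = \<lparr> scal = (\<lambda>h v. fls_compose_power h q * v),
                 oper = (\<lambda>v. puiseux_deriv q v + fls_X_intpow (- int q) * f * v) \<rparr>"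

definition phi :: "'k::field_char_0 fls \<Rightarrow> 'k fls" where
  "phi v = fls_compose_fps v (fps_X / (1 + fps_X))"

definition phi_ext :: "nat \<Rightarrow> 'k::field_char_0 fls \<Rightarrow> 'k fls" where
  "phi_ext q v =
     fls_compose_fps v (fps_X * fps_compose (fps_binomial (- 1 / of_nat q)) (fps_X ^ q))"

definition diff_operator :: "('k::field_char_0, 'v::ab_group_add) op_space \<Rightarrow> bool" where
  "diff_operator M \<longleftrightarrow> fin_dim_space (scal M) \<and> k_linear (scal M) (oper M) \<and> bij (oper M) \<and>
     (\<forall>h v. oper M (scal M h v) = scal M (phi h) (oper M v))"

definition D_obj :: "nat \<Rightarrow> 'k::field_char_0 fls \<Rightarrow> ('k, 'k fls) op_space" where
  "D_obj q g = \<lparr> scal = (\<lambda>h v. fls_compose_power h q * v),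
                 oper = (\<lambda>v. g * phi_ext q v) \<rparr>"

definition diff_iso ::
  "('k::field_char_0, 'v::ab_group_add) op_space \<Rightarrow> ('k, 'w::ab_group_add) op_space \<Rightarrow> bool" where
  "diff_iso M N \<longleftrightarrow> diff_operator M \<and> diff_operator N \<and>
     (\<exists>F. Vector_Spaces.linear (scal M) (scal N) F \<and> bij F \<and>
          (\<forall>v. F (oper M v) = oper N (F v)))"


subsection \<open>The local Mellin transform\<close>

text \<open>
  The \<open>\<k>[[z]]\<close>-lattices of a finite-dimensional \<open>\<k>((z))\<close>-space form a basis of
  neighbourhoods of \<open>0\<close> for its \<open>z\<close>-adic topology.
\<close>

definition lattice_in :: "('k::field fls \<Rightarrow> 'v::ab_group_add \<Rightarrow> 'v) \<Rightarrow> 'v set \<Rightarrow> bool" where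
  "lattice_in sc L \<longleftrightarrow> (\<exists>B. finite B \<and> module.span sc B = UNIV \<and>
     L = {\<Sum>b\<in>B. sc (fps_to_fls (c b)) b | c. True})"

definition adic_limit ::
  "('k::field fls \<Rightarrow> 'v::ab_group_add \<Rightarrow> 'v) \<Rightarrow> (nat \<Rightarrow> 'v) \<Rightarrow> 'v \<Rightarrow> bool" where
  "adic_limit sc X w \<longleftrightarrow> (\<forall>L. lattice_in sc L \<longrightarrow> (\<forall>\<^sub>F n in sequentially. X n - w \<in> L))"

definition z_nabla :: "('k::field, 'v::ab_group_add) op_space \<Rightarrow> 'v \<Rightarrow> 'v" where
  "z_nabla E v = scal E fls_X (oper E v)"

definition theta :: "('k::field, 'v::ab_group_add) op_space \<Rightarrow> 'v \<Rightarrow> 'v" where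
  "theta E v = - inv (z_nabla E) v"

definition theta_pow :: "('k::field, 'v::ab_group_add) op_space \<Rightarrow> int \<Rightarrow> 'v \<Rightarrow> 'v" where
  "theta_pow E i = (if 0 \<le> i then theta E ^^ nat i else inv (theta E) ^^ nat (- i))"

definition theta_partial ::
  "('k::field, 'v::ab_group_add) op_space \<Rightarrow> 'k fls \<Rightarrow> 'v \<Rightarrow> nat \<Rightarrow> 'v" where
  "theta_partial E h v n =
     (\<Sum>i\<in>{fls_subdegree h..int n}. scal E (fls_const (fls_nth h i)) (theta_pow E i v))"

text \<open>
  The action of \<open>\<k>((\<theta>))\<close> extending \<open>\<theta>\<close> is the continuous one: \<open>\<Sum> h\<^sub>i \<theta>\<^sup>i\<close> acts as the
  \<open>z\<close>-adic limit of its partial sums.  The transform is a total function here, which is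
  meaningful for those \<open>E\<close> that satisfy \<open>mellin_defined\<close>.
\<close>

definition mellin_defined :: "('k::field, 'v::ab_group_add) op_space \<Rightarrow> bool" where
  "mellin_defined E \<longleftrightarrow> connection E \<and> bij (z_nabla E) \<and>
     (\<forall>h v. \<exists>!w. adic_limit (scal E) (theta_partial E h v) w)"

definition local_mellin :: "('k::field, 'v::ab_group_add) op_space \<Rightarrow> ('k, 'v) op_space" where
  "local_mellin E = \<lparr> scal = (\<lambda>h v. THE w. adic_limit (scal E) (theta_partial E h v) w),
                      oper = scal E fls_X \<rparr>"


subsection \<open>The system of equations\<close>

text \<open>
  Write \<open>u = \<theta>\<^sup>1\<^sup>/\<^sup>s\<close>.  The series \<open>T\<close> is \<open>z\<^sup>1\<^sup>/\<^sup>r\<close> as an element of \<open>\<k>((u))\<close>, so that \<open>f(z)\<close>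
  is \<^term>\<open>fls_compose_fps f T\<close>.  A choice \<open>b = (-a)\<^sup>1\<^sup>/\<^sup>s\<close> fixes
  \<open>(-a)\<^sup>r\<^sup>/\<^sup>s = b\<^sup>r\<close>, the coefficient of the leading term of \<open>z = b\<^sup>r \<theta>\<^sup>r\<^sup>/\<^sup>s + \<dots>\<close>, and the
  same value is used in the second equation.
\<close>

definition solves_system ::
  "nat \<Rightarrow> nat \<Rightarrow> 'k::field_char_0 \<Rightarrow> 'k fls \<Rightarrow> 'k fls \<Rightarrow> bool" where
  "solves_system s r a f g \<longleftrightarrow> (\<exists>T b z.
     fps_nth T 0 = 0 \<and> fps_nth T 1 = b \<and> b ^ s = - a \<and>
     z = fps_to_fls (T ^ r) \<and>
     fls_compose_fps f T = - fls_X_intpow (- int s) \<and>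
     g = z - fls_const (b ^ r * (of_nat (r + s) / of_nat (2 * s))) * fls_X ^ (s + r))"

end

theory Submission
  imports Defs
begin

unbundle fps_syntax
unbundle Formal_Power_Series.fps_syntax

text \<open>
  Write \<open>t = z\<^sup>1\<^sup>/\<^sup>r\<close> and \<open>u = \<theta>\<^sup>1\<^sup>/\<^sup>s\<close>. On \<open>\<k>((t))\<close> the operator \<open>z \<nabla>\<close> of \<open>E\<^sub>f\<close> is \<open>z d/dz + f\<close>. If
  \<open>f(T(u)) = - u\<^sup>-\<^sup>s\<close>, the substitution \<open>t = T(u)\<close> turns \<open>- z \<nabla>\<close> into \<open>u\<^sup>-\<^sup>s - z d/dz\<close>, which differs from
  multiplication by \<open>u\<^sup>-\<^sup>s\<close> by an operator of higher order. The theorem says that this difference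
  can be removed by a change of basis in which multiplication by \<open>z\<close> becomes \<open>g \<phi>\<close>.

  The first part is \<open>intertwiner_exists\<close>: there is an operator \<open>H\<close> with
  \<open>H(u\<^sup>n) = u\<^sup>n \<Sum>\<^sub>j m\<^sub>j(n) u\<^sup>j\<close> and \<open>H u\<^sup>-\<^sup>s = (- z \<nabla>) H\<close>. One may think of \<open>H(u\<^sup>n)\<close> as \<open>\<theta>\<^sup>n\<^sup>/\<^sup>s\<close> applied to
  the vector \<open>1\<close>. For multiples \<open>n\<close> of \<open>s\<close> this has a meaning, and the other \<open>n\<close> are obtained by
  interpolation, since the coefficients \<open>m\<^sub>j\<close> can be taken to be polynomials in \<open>n\<close>: they solve difference
  equations \<open>m\<^sub>j(n) - m\<^sub>j(n - s) = \<dots>\<close>. The first nontrivial one is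
  \<open>m\<^sub>s(n) = n (n + s) / (2 s r)\<close>.

  The second part is \<open>difference_model\<close>. From \<open>z (- z \<nabla>) = (- z \<nabla> + 1) z\<close> and
  \<open>\<phi>(u\<^sup>-\<^sup>s) = u\<^sup>-\<^sup>s + 1\<close> it follows that multiplication by \<open>z\<close>, transported through \<open>H\<close>, and \<open>\<phi>\<close> satisfy the same
  commutation rule with \<open>u\<^sup>-\<^sup>s\<close>. An operator that obeys this rule and kills \<open>1\<close> kills all powers of
  \<open>u\<^sup>s\<close>, and if its coefficients are polynomial in \<open>n\<close>, it is zero (\<open>polynomial_op_eq_0\<close>). Therefore
  \<open>z\<close> acts as \<open>g \<phi>\<close> as soon as it does so on the vector \<open>1\<close>. There the terms of degree at most
  \<open>r + s\<close> decide: \<open>Z H(u\<^sup>i) - H(g u\<^sup>i)\<close> with \<open>Z = T\<^sup>r\<close> starts with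
  \<open>b\<^sup>r ((r + s)/(2 s) + m\<^sub>s(i) - m\<^sub>s(r + i)) = - b\<^sup>r i / s\<close> in degree \<open>i + r + s\<close>. It vanishes for \<open>i = 0\<close>
  and only then, so that a rescaling of \<open>1\<close> by a unit \<open>w\<close> removes all the remaining terms.

  Given this model, \<open>\<theta>\<close> is multiplication by \<open>u\<^sup>s\<close> and all assertions about the transform can be read
  off by continuity (\<open>local_mellin_model\<close>). That \<open>g\<close> cannot be represented over a smaller field
  is a separate argument with roots of unity (\<open>S_circ_of_system\<close>).
\<close>

section \<open>Filtered operators on Laurent series\<close>

definition order_ge :: "int \<Rightarrow> 'a::zero fls \<Rightarrow> bool" where
  "order_ge N v \<longleftrightarrow> (\<forall>i<N. v $$ i = 0)"

lemma order_ge_0 [simp]: "order_ge N 0"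
  by (simp add: order_ge_def)

lemma order_ge_mono: "order_ge N v \<Longrightarrow> M \<le> N \<Longrightarrow> order_ge M v"
  by (auto simp: order_ge_def)

lemma order_ge_subdegree: "order_ge (fls_subdegree v) v"
  by (simp add: order_ge_def)

lemma order_ge_add: "order_ge N v \<Longrightarrow> order_ge N w \<Longrightarrow> order_ge N (v + w)"
  for v w :: "'a::monoid_add fls"
  by (simp add: order_ge_def)

lemma order_ge_diff: "order_ge N v \<Longrightarrow> order_ge N w \<Longrightarrow> order_ge N (v - w)"
  for v w :: "'a::group_add fls"
  by (simp add: order_ge_def)

lemma order_ge_uminus: "order_ge N v \<Longrightarrow> order_ge N (- v)"
  for v :: "'a::group_add fls"
  by (simp add: order_ge_def)

lemma order_ge_sum: "(\<And>x. x \<in> I \<Longrightarrow> order_ge N (f x)) \<Longrightarrow> order_ge N (sum f I)"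
  for f :: "'b \<Rightarrow> 'a::comm_monoid_add fls"
  by (simp add: order_ge_def fls_nth_sum)

lemma order_ge_const_mult: "order_ge N v \<Longrightarrow> order_ge N (fls_const c * v)"
  for v :: "'a::field fls"
  by (simp add: order_ge_def)

lemma order_ge_fps [simp]: "order_ge 0 (fps_to_fls p)"
  by (simp add: order_ge_def)

lemma order_ge_iff_subdegree: "order_ge N v \<longleftrightarrow> v = 0 \<or> N \<le> fls_subdegree v"
proof (cases "v = 0")
  case False
  show ?thesis
  proof
    assume "order_ge N v"
    then show "v = 0 \<or> N \<le> fls_subdegree v"
      using fls_subdegree_geI[OF False] by (simp add: order_ge_def)
  next
    assume "v = 0 \<or> N \<le> fls_subdegree v"
    with False show "order_ge N v"
      using order_ge_mono[OF order_ge_subdegree] by blast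
  qed
qed simp

lemma order_ge_X_intpow [simp]: "order_ge N (fls_shift m 1 :: 'a::field fls) \<longleftrightarrow> N \<le> - m"
  by (auto simp: order_ge_iff_subdegree fls_shift_eq0_iff)

lemma order_ge_mult:
  fixes v w :: "'a::field fls"
  assumes "order_ge M v" "order_ge N w"
  shows "order_ge (M + N) (v * w)"
proof (cases "v = 0 \<or> w = 0")
  case False
  with assms show ?thesis by (simp add: order_ge_iff_subdegree)
qed auto

lemma order_ge_all_imp_0: "(\<And>k::nat. order_ge (N + int k) v) \<Longrightarrow> v = 0"
proof (rule fls_zero_eqI)
  fix n assume "\<And>k::nat. order_ge (N + int k) v"
  from this[of "nat (n + 1 - N)"] show "v $$ n = 0" by (auto simp: order_ge_def)
qed

lemma order_ge_Suc: "order_ge N v \<Longrightarrow> v $$ N = 0 \<Longrightarrow> order_ge (N + 1) v"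
  unfolding order_ge_def by (metis order_le_less zless_add1_eq)

lemma fls_times_nth_order_ge:
  fixes v w :: "'a::field fls"
  assumes "order_ge M v" "order_ge N w"
  shows "(v * w) $$ n = (\<Sum>i=M..n-N. v $$ i * w $$ (n - i))"
proof (cases "v = 0 \<or> w = 0")
  case False
  then have M: "M \<le> fls_subdegree v" and N: "N \<le> fls_subdegree w"
    using assms by (auto simp: order_ge_iff_subdegree)
  have "(v * w) $$ n = (\<Sum>i=fls_subdegree v..n-fls_subdegree w. v $$ i * w $$ (n - i))"
    by (rule fls_times_nth(2))
  also have "\<dots> = (\<Sum>i=M..n-N. v $$ i * w $$ (n - i))"
    by (rule sum.mono_neutral_left) (use M N in \<open>auto simp: not_le\<close>)
  finally show ?thesis .
qed auto

lemma fls_times_nth_leading: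
  fixes v w :: "'a::field fls"
  assumes "order_ge M v" "order_ge N w"
  shows "(v * w) $$ (M + N) = v $$ M * w $$ N"
  by (simp add: fls_times_nth_order_ge[OF assms])

text \<open>
  The \<open>\<k>\<close>-linear operators that raise the order by at least \<open>c\<close>. They are continuous, so each
  is determined by its values on the monomials, whose coefficients play the role of an infinite
  matrix with only finitely many entries relevant to each coefficient of a value.
\<close>

definition filtered :: "int \<Rightarrow> ('a::field fls \<Rightarrow> 'a fls) \<Rightarrow> bool" where
  "filtered c A \<longleftrightarrow> (\<forall>v w. A (v + w) = A v + A w) \<and> (\<forall>x v. A (fls_const x * v) = fls_const x * A v) \<and>
     (\<forall>N v. order_ge N v \<longrightarrow> order_ge (N + c) (A v))"

lemma filtered_add: "filtered c A \<Longrightarrow> A (v + w) = A v + A w"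
  and filtered_scale: "filtered c A \<Longrightarrow> A (fls_const x * v) = fls_const x * A v"
  and filtered_order: "filtered c A \<Longrightarrow> order_ge N v \<Longrightarrow> order_ge (N + c) (A v)"
  by (auto simp: filtered_def)

lemma filtered_0: "filtered c A \<Longrightarrow> A 0 = 0"
  using filtered_scale[of c A 0 0] by simp

lemma filtered_diff: "filtered c A \<Longrightarrow> A (v - w) = A v - A w"
  using filtered_add[of c A "v - w" w] by simp

lemma filtered_uminus: "filtered c A \<Longrightarrow> A (- v) = - A v"
  using filtered_diff[of c A 0 v] filtered_0[of c A] by simp

lemma filtered_sum: "filtered c A \<Longrightarrow> A (sum f I) = (\<Sum>i\<in>I. A (f i))"
  by (induction I rule: infinite_finite_induct) (auto simp: filtered_0 filtered_add)

lemma filtered_mono: "filtered c A \<Longrightarrow> d \<le> c \<Longrightarrow> filtered d A"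
  unfolding filtered_def by (meson add_left_mono order_ge_mono)

lemma filtered_comp:
  fixes A B :: "'a::field fls \<Rightarrow> 'a fls"
  assumes "filtered c A" "filtered d B"
  shows "filtered (c + d) (\<lambda>v. A (B v))"
  unfolding filtered_def
proof (intro conjI allI impI)
  fix N and v :: "'a fls" assume "order_ge N v"
  from filtered_order[OF assms(1) filtered_order[OF assms(2) this]]
  show "order_ge (N + (c + d)) (A (B v))" by (simp add: add_ac)
qed (simp_all add: filtered_add[OF assms(1)] filtered_add[OF assms(2)] filtered_scale[OF assms(1)]
    filtered_scale[OF assms(2)])

lemma filtered_fun_diff:
  assumes "filtered c A" "filtered c B"
  shows "filtered c (\<lambda>v. A v - B v)"
  using assms unfolding filtered_def by (auto simp: algebra_simps order_ge_diff)

lemma filtered_fun_add: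
  assumes "filtered c A" "filtered c B"
  shows "filtered c (\<lambda>v. A v + B v)"
  using assms unfolding filtered_def by (auto simp: algebra_simps order_ge_add)

lemma filtered_mult: "order_ge c f \<Longrightarrow> filtered c (\<lambda>v. f * v)"
  unfolding filtered_def by (auto simp: algebra_simps intro: order_ge_mult)

lemma filtered_deriv: "filtered (-1) (fls_deriv :: 'a::field fls \<Rightarrow> 'a fls)"
  unfolding filtered_def
proof (intro conjI allI impI)
  fix N and v :: "'a fls"
  assume "order_ge N v"
  then show "order_ge (N + -1) (fls_deriv v)" unfolding order_ge_def by auto
qed simp_all

lemma fls_eq_sum_plus_tail:
  fixes v :: "'a::field fls"
  assumes "order_ge N v"
  shows "\<exists>w. order_ge K w \<and> v = (\<Sum>n=N..K-1. fls_const (v $$ n) * fls_X_intpow n) + w"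
proof (intro exI conjI)
  let ?p = "\<Sum>n=N..K-1. fls_const (v $$ n) * fls_X_intpow n"
  have *: "?p $$ i = (if N \<le> i \<and> i < K then v $$ i else 0)" for i
  proof -
    have "?p $$ i = (\<Sum>n=N..K-1. if n = i then v $$ n else 0)"
      unfolding fls_nth_sum by (rule sum.cong) (auto simp: fls_X_intpow_times_conv_shift)
    then show ?thesis by auto
  qed
  show "order_ge K (v - ?p)"
    using assms by (auto simp: order_ge_def *)
  show "v = ?p + (v - ?p)" by simp
qed

lemma filtered_nth:
  assumes A: "filtered c A" and v: "order_ge N v"
  shows "A v $$ k = (\<Sum>n=N..k-c. v $$ n * A (fls_X_intpow n) $$ k)"
proof -
  obtain w where w: "order_ge (k - c + 1) w"
    and eq: "v = (\<Sum>n=N..k-c+1-1. fls_const (v $$ n) * fls_X_intpow n) + w"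
    using fls_eq_sum_plus_tail[OF v] by blast
  have "order_ge (k + 1) (A w)"
    using filtered_order[OF A w] by simp
  then have "A w $$ k = 0" by (auto simp: order_ge_def)
  have "A v = (\<Sum>n=N..k-c. fls_const (v $$ n) * A (fls_X_intpow n)) + A w"
    by (subst eq) (simp add: filtered_add[OF A] filtered_sum[OF A] filtered_scale[OF A])
  then show ?thesis
    using \<open>A w $$ k = 0\<close> by (simp add: fls_nth_sum)
qed

lemma filtered_eqI:
  assumes A: "filtered c A" and B: "filtered d B"
    and "\<And>n. A (fls_X_intpow n) = B (fls_X_intpow n)"
  shows "A v = B v"
proof (rule fls_eqI)
  fix k
  define e where "e = min c d"
  have A': "filtered e A" and B': "filtered e B"
    using A B filtered_mono unfolding e_def by (metis min.cobounded1, metis min.cobounded2)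
  show "A v $$ k = B v $$ k"
    unfolding filtered_nth[OF A' order_ge_subdegree[of v]] filtered_nth[OF B' order_ge_subdegree[of v]]
    by (simp add: assms(3))
qed

text \<open>
  Continuity extends an estimate from monomials to all series; this is how cancellations between
  leading terms become visible as a higher filtration degree.
\<close>

lemma filtered_raise:
  fixes A :: "'a::field fls \<Rightarrow> 'a fls"
  assumes A: "filtered d A" and "\<And>n. order_ge (n + c) (A (fls_X_intpow n))"
  shows "filtered c A"
  unfolding filtered_def
proof (intro conjI allI impI)
  fix N and v :: "'a fls" assume v: "order_ge N v"
  show "order_ge (N + c) (A v)"
    unfolding order_ge_def
  proof (intro allI impI)
    fix i assume i: "i < N + c"
    show "A v $$ i = 0"
      unfolding filtered_nth[OF A v]
      by (rule sum.neutral) (use assms(2) i in \<open>auto simp: order_ge_def\<close>)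
  qed
qed (use filtered_add[OF A] filtered_scale[OF A] in auto)

lemma filtered_nth_leading:
  assumes A: "filtered c A" and v: "order_ge N v"
  shows "A v $$ (N + c) = v $$ N * A (fls_X_intpow N) $$ (N + c)"
  by (simp add: filtered_nth[OF assms])

lemma filtered_exists:
  fixes M :: "int \<Rightarrow> 'a::field fls"
  assumes M: "\<And>n. order_ge n (M n)"
  obtains A where "filtered 0 A" "\<And>n. A (fls_X_intpow n) = M n"
proof
  define A where "A = (\<lambda>v. Abs_fls (\<lambda>k. \<Sum>n=fls_subdegree v..k. v $$ n * M n $$ k))"
  have nth: "A v $$ k = (\<Sum>n=N..k. v $$ n * M n $$ k)" if v: "order_ge N v" for N v k
  proof -
    have "A v $$ k = (\<Sum>n=fls_subdegree v..k. v $$ n * M n $$ k)"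
      unfolding A_def by (rule nth_Abs_fls_lower_bound[of "fls_subdegree v"]) auto
    also have "\<dots> = (\<Sum>n=N..k. v $$ n * M n $$ k)"
    proof (cases "v = 0")
      case False
      with v have "N \<le> fls_subdegree v" by (simp add: order_ge_iff_subdegree)
      then show ?thesis by (intro sum.mono_neutral_left) auto
    qed auto
    finally show ?thesis .
  qed
  show "filtered 0 A"
    unfolding filtered_def
  proof (intro conjI allI impI)
    fix v w :: "'a fls"
    define N where "N = min (fls_subdegree v) (fls_subdegree w)"
    have v: "order_ge N v" and w: "order_ge N w"
      using order_ge_mono[OF order_ge_subdegree] unfolding N_def by (metis min.cobounded1, metis min.cobounded2)
    show "A (v + w) = A v + A w"
      by (rule fls_eqI)
        (simp add: nth[OF v] nth[OF w] nth[OF order_ge_add[OF v w]] ring_distribs sum.distrib)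
  next
    fix x and v :: "'a fls"
    have v: "order_ge (fls_subdegree v) v" by (rule order_ge_subdegree)
    show "A (fls_const x * v) = fls_const x * A v"
      by (rule fls_eqI) (simp add: nth[OF v] nth[OF order_ge_const_mult[OF v]] sum_distrib_left mult.assoc)
  next
    fix N and v :: "'a fls" assume v: "order_ge N v"
    show "order_ge (N + 0) (A v)"
      by (simp add: order_ge_def nth[OF v])
  qed
  show "A (fls_X_intpow n) = M n" for n
  proof (rule fls_eqI)
    fix k
    have "A (fls_X_intpow n) $$ k = (\<Sum>m=n..k. if m = n then M n $$ k else 0)"
    proof (subst nth[of n])
      show "(\<Sum>m=n..k. fls_X_intpow n $$ m * M m $$ k) = (\<Sum>m=n..k. if m = n then M n $$ k else 0)"
        by (rule sum.cong) auto
    qed simp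
    then show "A (fls_X_intpow n) $$ k = M n $$ k"
      using M[of n] by (auto simp: order_ge_def)
  qed
qed

text \<open>
  Successive approximation: if the leading coefficients on the monomials of order at least \<open>N\<close> do
  not vanish, the leading term of the remainder can always be removed, and the corrections form a
  convergent series. Monomials of order below \<open>N\<close> are exempt, which allows operators that
  degenerate on a single monomial.
\<close>

lemma filtered_solve:
  assumes A: "filtered c A" and lead: "\<And>n. n \<ge> N \<Longrightarrow> A (fls_X_intpow n) $$ (n + c) \<noteq> 0"
    and w: "order_ge (N + c) w"
  obtains v where "order_ge N v" "A v = w"
proof -
  \<comment> \<open>\<open>R k\<close> is the remainder after \<open>k\<close> corrections, and \<open>x k r\<close> the next coefficient that the remainder \<open>r\<close> calls for.\<close>
  define x where "x = (\<lambda>k r. r $$ (N + int k + c) / A (fls_X_intpow (N + int k)) $$ (N + int k + c))"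
  define R where "R = rec_nat w (\<lambda>k r. r - A (fls_const (x k r) * fls_X_intpow (N + int k)))"
  have R_0: "R 0 = w" and R_Suc: "R (Suc k) = R k - A (fls_const (x k (R k)) * fls_X_intpow (N + int k))" for k
    by (simp_all add: R_def)
  define y where "y = (\<lambda>k. x k (R k))"
  define v where "v = fls_shift (-N) (fps_to_fls (Abs_fps y))"
  have v: "order_ge N v" by (simp add: v_def order_ge_def)
  have R_order: "order_ge (N + c + int k) (R k)" for k
  proof (induction k)
    case 0
    then show ?case using w by (simp add: R_0)
  next
    case (Suc k)
    have "order_ge (N + int k + c) (A (fls_const (x k (R k)) * fls_X_intpow (N + int k)))"
      by (intro filtered_order[OF A] order_ge_const_mult) simp
    then have 1: "order_ge (N + c + int k) (R (Suc k))"
      unfolding R_Suc by (intro order_ge_diff Suc) (simp add: add_ac)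
    have 2: "R (Suc k) $$ (N + c + int k) = 0"
      unfolding R_Suc filtered_scale[OF A] using lead[of "N + int k"] by (simp add: x_def add_ac)
    show ?case
      using order_ge_Suc[OF 1 2] by (simp add: add_ac)
  qed
  have R_eq: "w - R k = A (\<Sum>n<k. fls_const (y n) * fls_X_intpow (N + int n))" for k
  proof (induction k)
    case (Suc k)
    have "w - R (Suc k) = (w - R k) + A (fls_const (y k) * fls_X_intpow (N + int k))"
      by (simp add: R_Suc y_def)
    then show ?case unfolding Suc by (simp add: filtered_add[OF A] add.commute)
  qed (simp add: R_0 filtered_0[OF A])
  have "order_ge (N + c + int k) (A v - w)" for k
  proof -
    let ?p = "\<Sum>n<k. fls_const (y n) * fls_X_intpow (N + int n)"
    have "v $$ i = ?p $$ i" if "i < N + int k" for i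
    proof -
      have "?p $$ i = (\<Sum>n<k. if n = nat (i - N) \<and> i \<ge> N then y n else 0)"
        unfolding fls_nth_sum by (rule sum.cong) (auto simp: fls_X_intpow_times_conv_shift)
      then show ?thesis using that by (cases "i \<ge> N") (auto simp: v_def)
    qed
    then have "order_ge (N + int k) (v - ?p)" by (simp add: order_ge_def)
    from filtered_order[OF A this] have 1: "order_ge (N + c + int k) (A v - A ?p)"
      by (simp add: filtered_diff[OF A] add_ac)
    have "A v - w = (A v - A ?p) - R k"
      unfolding R_eq[of k, symmetric] by simp
    then show ?thesis using order_ge_diff[OF 1 R_order] by (simp only:)
  qed
  from order_ge_all_imp_0[OF this] have "A v = w" by simp
  with v show thesis by (rule that)
qed

text \<open>
  The operators that change the order of every nonzero series by exactly \<open>c\<close>.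
\<close>

definition exact :: "int \<Rightarrow> ('a::field fls \<Rightarrow> 'a fls) \<Rightarrow> bool" where
  "exact c A \<longleftrightarrow> filtered c A \<and> (\<forall>n. A (fls_X_intpow n) $$ (n + c) \<noteq> 0)"

lemma exact_order_iff:
  assumes "exact c A"
  shows "order_ge (N + c) (A v) \<longleftrightarrow> order_ge N v"
proof
  have A: "filtered c A" and lead: "\<And>n. A (fls_X_intpow n) $$ (n + c) \<noteq> 0"
    using assms by (auto simp: exact_def)
  show "order_ge N v \<Longrightarrow> order_ge (N + c) (A v)" by (rule filtered_order[OF A])
  assume *: "order_ge (N + c) (A v)"
  show "order_ge N v"
  proof (rule ccontr)
    assume "\<not> order_ge N v"
    then have v: "v \<noteq> 0" "fls_subdegree v < N" by (auto simp: order_ge_iff_subdegree)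
    have "A v $$ (fls_subdegree v + c) \<noteq> 0"
      using filtered_nth_leading[OF A order_ge_subdegree[of v]] lead v(1) by simp
    with * v(2) show False by (auto simp: order_ge_def)
  qed
qed

lemma exact_filtered: "exact c A \<Longrightarrow> filtered c A"
  by (simp add: exact_def)

lemma exact_bij:
  fixes A :: "'a::field fls \<Rightarrow> 'a fls"
  assumes "exact c A"
  shows "bij A"
proof (rule bijI)
  have A: "filtered c A" using assms by (simp add: exact_def)
  show "inj A"
  proof (rule injI)
    fix v w :: "'a fls" assume "A v = A w"
    then have "A (v - w) = 0" by (simp add: filtered_diff[OF A])
    then have "order_ge (0 + int k) (v - w)" for k
      using exact_order_iff[OF assms, of "0 + int k" "v - w"] by simp
    from order_ge_all_imp_0[OF this] show "v = w" by simp
  qed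
  show "surj A"
    unfolding surj_def
  proof
    fix w :: "'a fls"
    have "order_ge (fls_subdegree w - c + c) w" by (simp add: order_ge_subdegree)
    then obtain v where "A v = w"
      using filtered_solve[OF A, of "fls_subdegree w - c" w] assms by (auto simp: exact_def)
    then show "\<exists>v. w = A v" by auto
  qed
qed

lemma exact_inv:
  fixes A :: "'a::field fls \<Rightarrow> 'a fls"
  assumes "exact c A"
  shows "exact (- c) (inv A)"
proof -
  have A: "filtered c A" by (rule exact_filtered[OF assms])
  have bij: "bij A" by (rule exact_bij[OF assms])
  have AI: "A (inv A v) = v" for v using bij by (simp add: bij_is_surj surj_f_inv_f)
  have I: "inv A (A v) = v" for v using bij by (simp add: bij_is_inj)
  have filt: "filtered (- c) (inv A)"
    unfolding filtered_def
  proof (intro conjI allI impI)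
    fix v w :: "'a fls" show "inv A (v + w) = inv A v + inv A w"
      by (metis AI I filtered_add[OF A])
  next
    fix x and v :: "'a fls" show "inv A (fls_const x * v) = fls_const x * inv A v"
      by (metis AI I filtered_scale[OF A])
  next
    fix N and v :: "'a fls" assume "order_ge N v"
    then show "order_ge (N + - c) (inv A v)"
      using exact_order_iff[OF assms, of "N - c" "inv A v"] by (simp add: AI)
  qed
  have "\<not> inv A (fls_X_intpow n) $$ (n + - c) = 0" for n
  proof
    assume *: "inv A (fls_X_intpow n) $$ (n + - c) = 0"
    have "order_ge (n - c) (inv A (fls_X_intpow n))"
      using filtered_order[OF filt, of n "fls_X_intpow n"] by simp
    from filtered_nth_leading[OF A this] * show False by (simp add: AI)
  qed
  with filt show ?thesis by (simp add: exact_def)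
qed

lemma exact_comp:
  assumes "exact c A" "exact d B"
  shows "exact (c + d) (\<lambda>v. A (B v))"
  unfolding exact_def
proof (intro conjI allI)
  show "filtered (c + d) (\<lambda>v. A (B v))"
    by (intro filtered_comp exact_filtered assms)
  fix n
  have "order_ge (n + d) (B (fls_X_intpow n))"
    using filtered_order[OF exact_filtered[OF assms(2)]] by simp
  from filtered_nth_leading[OF exact_filtered[OF assms(1)] this]
  have "A (B (fls_X_intpow n)) $$ (n + d + c) =
      B (fls_X_intpow n) $$ (n + d) * A (fls_X_intpow (n + d)) $$ (n + d + c)" .
  moreover have "B (fls_X_intpow n) $$ (n + d) \<noteq> 0" "A (fls_X_intpow (n + d)) $$ (n + d + c) \<noteq> 0"
    using assms unfolding exact_def by blast+
  ultimately have "A (B (fls_X_intpow n)) $$ (n + d + c) \<noteq> 0" by simp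
  then show "A (B (fls_X_intpow n)) $$ (n + (c + d)) \<noteq> 0"
    by (simp only: add.assoc add.commute[of c d] not_False_eq_True)
qed

section \<open>Substitution of power series\<close>

lemma fls_shift_1_times: "fls_shift n 1 * f = fls_shift n f" for f :: "'a::field fls"
  using fls_X_intpow_times_conv_shift(1)[of "- n" f] by simp

lemma fls_compose_power_conv_compose_fps:
  fixes h :: "'a::field fls"
  assumes "d > 0"
  shows "fls_compose_power h d = fls_compose_fps h (fps_X ^ d)"
proof -
  define n where "n = fls_subdegree h"
  define p where "p = fls_base_factor_to_fps h"
  have h: "h = fls_shift (- n) (fps_to_fls p)"
    unfolding p_def n_def by (rule fls_conv_base_factor_to_fps_shift_subdegree)
  have [simp]: "(fps_X ^ d :: 'a fps) \<noteq> 0" "(fps_X ^ d :: 'a fps) $ 0 = 0" using assms by auto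
  have "fps_to_fls (fps_X ^ d :: 'a fps) powi n = fls_X_intpow (int d * n)"
    by (simp only: fps_to_fls_power fps_X_to_fls power_int_mult power_int_of_nat flip: fls_X_power_int)
  then show ?thesis
    using assms
    by (simp add: h fls_compose_fps_shift fls_compose_power_fps_to_fls fls_X_intpow_times_conv_shift)
qed

lemma fls_compose_fps_X_intpow:
  fixes T :: "'a::field fps"
  assumes "T \<noteq> 0" "T $ 0 = 0"
  shows "fls_compose_fps (fls_X_intpow n) T = fps_to_fls T powi n"
  using fls_compose_fps_powi[OF assms, of fls_X n] by simp

lemma fps_order1_nonzero: "T $ 1 \<noteq> 0 \<Longrightarrow> T \<noteq> 0" for T :: "'a::zero fps"
  by auto

lemma subdegree_order1: "T $ 0 = 0 \<Longrightarrow> T $ 1 \<noteq> 0 \<Longrightarrow> subdegree T = 1" for T :: "'a::zero fps"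
  by (rule subdegreeI) auto

lemma exact_compose_fps:
  fixes T :: "'a::field fps"
  assumes T: "T $ 0 = 0" "T $ 1 \<noteq> 0"
  shows "exact 0 (\<lambda>v. fls_compose_fps v T)"
proof -
  note T0 = fps_order1_nonzero[OF T(2)]
  note sub = subdegree_order1[OF T]
  have "fls_compose_fps (fls_X_intpow n) T $$ n \<noteq> 0" for n
  proof -
    have "fls_compose_fps (fls_X_intpow n) T \<noteq> 0"
      by (simp add: fls_compose_fps_eq_0_iff T0 T fls_shift_eq0_iff)
    moreover have "fls_subdegree (fls_compose_fps (fls_X_intpow n) T) = n"
      using T by (simp add: sub)
    ultimately show ?thesis by (metis nth_fls_subdegree_nonzero)
  qed
  moreover have "order_ge N (fls_compose_fps v T)" if "order_ge N v" for N v
    using that T T0 by (auto simp: order_ge_iff_subdegree sub)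
  ultimately show ?thesis
    by (simp add: exact_def filtered_def fls_compose_fps_add fls_compose_fps_mult T T0)
qed

lemma fls_deriv_power_int:
  fixes g :: "'a::field fls"
  assumes "g \<noteq> 0"
  shows "fls_deriv (g powi n) = of_int n * g powi (n - 1) * fls_deriv g"
proof (cases "n \<ge> 0")
  case True
  then obtain m where n: "n = int m" using nonneg_int_cases by blast
  have "fls_deriv (g powi n) = of_nat m * fls_deriv g * g ^ (m - 1)"
    unfolding n power_int_of_nat by (simp add: fls_deriv_power mult_ac)
  then show ?thesis
    by (cases m) (simp_all add: n mult_ac)
next
  case False
  define m where "m = nat (- n)"
  have n: "n = - int m" "m > 0" using False by (simp_all add: m_def)
  have [simp]: "g ^ m \<noteq> 0" using assms by simp
  have "g powi n = inverse (g ^ m)" by (simp add: n power_int_minus)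
  then have "fls_deriv (g powi n) = - fls_deriv (g ^ m) * inverse (g ^ m) ^ 2"
    by (simp add: fls_inverse_deriv)
  also have "\<dots> = - (of_nat m * fls_deriv g * g ^ (m - 1)) * inverse (g ^ m) ^ 2"
    by (simp add: fls_deriv_power)
  also have "g ^ (m - 1) = g ^ m / g"
    using assms n(2) by (cases m) auto
  also have "- (of_nat m * fls_deriv g * (g ^ m / g)) * inverse (g ^ m) ^ 2
      = of_int n * (inverse (g ^ m) / g) * fls_deriv g"
    using assms by (simp add: n field_simps power2_eq_square)
  also have "inverse (g ^ m) / g = g powi (n - 1)"
    using assms by (simp add: n power_int_diff power_int_minus)
  finally show ?thesis .
qed

text \<open>
  Both sides are filtered operators of \<open>v\<close>, so only powers of the variable have to be compared.
\<close>

lemma fls_deriv_compose_fps: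
  fixes T :: "'a::field fps"
  assumes T: "T $ 0 = 0" "T $ 1 \<noteq> 0"
  shows "fls_deriv (fls_compose_fps v T) = fls_compose_fps (fls_deriv v) T * fls_deriv (fps_to_fls T)"
proof -
  note T0 = fps_order1_nonzero[OF T(2)]
  note C = exact_filtered[OF exact_compose_fps[OF T]]
  have 1: "filtered (-1 + 0) (\<lambda>v. fls_deriv (fls_compose_fps v T))"
    by (rule filtered_comp[OF filtered_deriv C])
  have "order_ge 0 (fls_deriv (fps_to_fls T))"
    by (simp add: fls_deriv_fps_to_fls)
  from filtered_comp[OF filtered_mult[OF this] filtered_comp[OF C filtered_deriv]]
  have 2: "filtered (0 + (0 + -1)) (\<lambda>v. fls_deriv (fps_to_fls T) * fls_compose_fps (fls_deriv v) T)" .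
  have "fls_deriv (fls_compose_fps v T) = fls_deriv (fps_to_fls T) * fls_compose_fps (fls_deriv v) T"
  proof (rule filtered_eqI[OF 1 2])
    fix n
    have "fls_deriv (fls_X_intpow n :: 'a fls) = of_int n * fls_X_intpow (n - 1)"
      using fls_deriv_power_int[of "fls_X :: 'a fls" n] by simp
    then show "fls_deriv (fls_compose_fps (fls_X_intpow n) T)
        = fls_deriv (fps_to_fls T) * fls_compose_fps (fls_deriv (fls_X_intpow n)) T"
      unfolding fls_compose_fps_X_intpow[OF T0 T(1)]
      using fls_deriv_power_int[of "fps_to_fls T" n] T0
      by (simp only: fls_compose_fps_mult[OF T0 T(1)] fls_compose_fps_X_intpow[OF T0 T(1)]
           fls_compose_fps_of_int fps_to_fls_eq_0_iff mult_ac not_False_eq_True)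
  qed
  then show ?thesis by (simp add: mult.commute)
qed

section \<open>Operators with polynomial coefficients\<close>

definition poly_fun :: "(int \<Rightarrow> 'a::comm_ring_1) \<Rightarrow> bool" where
  "poly_fun c \<longleftrightarrow> (\<exists>p. \<forall>n. c n = poly p (of_int n))"

lemma poly_fun_poly [intro]: "poly_fun (\<lambda>n. poly p (of_int n))"
  by (auto simp: poly_fun_def)

lemma poly_fun_const [intro]: "poly_fun (\<lambda>n. x)"
  using poly_fun_poly[of "[:x:]"] by simp

lemma poly_fun_of_int [intro]: "poly_fun (\<lambda>n. of_int n)"
  using poly_fun_poly[of "[:0, 1:]"] by simp

lemma poly_fun_add [intro]: "poly_fun c \<Longrightarrow> poly_fun d \<Longrightarrow> poly_fun (\<lambda>n. c n + d n)"
  unfolding poly_fun_def by (metis poly_add)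

lemma poly_fun_diff [intro]: "poly_fun c \<Longrightarrow> poly_fun d \<Longrightarrow> poly_fun (\<lambda>n. c n - d n)"
  unfolding poly_fun_def by (metis poly_diff)

lemma poly_fun_mult [intro]: "poly_fun c \<Longrightarrow> poly_fun d \<Longrightarrow> poly_fun (\<lambda>n. c n * d n)"
  unfolding poly_fun_def by (metis poly_mult)

lemma poly_fun_sum [intro]: "(\<And>i. i \<in> I \<Longrightarrow> poly_fun (c i)) \<Longrightarrow> poly_fun (\<lambda>n. \<Sum>i\<in>I. c i n)"
  by (induction I rule: infinite_finite_induct) auto

lemma poly_fun_prod [intro]: "(\<And>i. i \<in> I \<Longrightarrow> poly_fun (c i)) \<Longrightarrow> poly_fun (\<lambda>n. \<Prod>i\<in>I. c i n)"
  by (induction I rule: infinite_finite_induct) auto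

lemma poly_fun_translate [intro]:
  assumes "poly_fun c"
  shows "poly_fun (\<lambda>n. c (n + i))"
proof -
  obtain p where p: "\<And>n. c n = poly p (of_int n)"
    using assms by (auto simp: poly_fun_def)
  have "c (n + i) = poly (pcompose p [:of_int i, 1:]) (of_int n)" for n
    by (simp add: p poly_pcompose add.commute)
  then show ?thesis by (auto simp: poly_fun_def)
qed

lemma poly_fun_gbinomial:
  fixes c :: "int \<Rightarrow> 'a::field_char_0"
  assumes "poly_fun c"
  shows "poly_fun (\<lambda>n. c n gchoose k)"
proof -
  have "poly_fun (\<lambda>n. (\<Prod>i=0..<k. c n - of_nat i) * inverse (fact k))"
    using assms by (intro poly_fun_mult poly_fun_prod poly_fun_diff poly_fun_const)
  then show ?thesis by (simp add: gbinomial_prod_rev divide_inverse)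
qed

lemma poly_fun_eq_0:
  fixes c :: "int \<Rightarrow> 'a::field_char_0"
  assumes "poly_fun c" "s > 0" "\<And>k. c (int s * k) = 0"
  shows "c n = 0"
proof -
  obtain p where p: "\<And>n. c n = poly p (of_int n)"
    using assms(1) by (auto simp: poly_fun_def)
  have "p = 0"
  proof (rule ccontr)
    assume "p \<noteq> 0"
    then have "finite {x. poly p x = 0}" by (rule poly_roots_finite)
    moreover have "range (\<lambda>k::int. of_int (int s * k) :: 'a) \<subseteq> {x. poly p x = 0}"
      using assms(3) by (auto simp: p)
    ultimately have "finite (range (\<lambda>k::int. of_int (int s * k) :: 'a))"
      using finite_subset by blast
    moreover have "inj (\<lambda>k::int. of_int (int s * k) :: 'a)"
      using assms(2) by (auto simp: inj_def simp del: of_int_mult)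
    ultimately show False
      using finite_imageD infinite_UNIV_int by blast
  qed
  then show ?thesis by (simp add: p)
qed

text \<open>
  Operators of the form \<open>\<Sum>\<^sub>j u\<^sup>j p\<^sub>j(u d/du)\<close> with polynomials \<open>p\<^sub>j\<close>, described through their
  matrix: on each diagonal the entries are polynomial in the exponent \<open>n\<close> of the monomial.
\<close>

definition polynomial_op :: "('a::field fls \<Rightarrow> 'a fls) \<Rightarrow> bool" where
  "polynomial_op A \<longleftrightarrow> (\<forall>j. poly_fun (\<lambda>n. A (fls_X_intpow n) $$ (n + j)))"

text \<open>
  On a fixed diagonal, the product of the two matrices is a sum of products of diagonal entries
  over a range of diagonals that is independent of \<open>n\<close>.
\<close>

lemma polynomial_op_comp:
  assumes A: "filtered c A" "polynomial_op A" and B: "filtered d B" "polynomial_op B"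
  shows "polynomial_op (\<lambda>v. A (B v))"
  unfolding polynomial_op_def
proof
  fix j
  have eq: "A (B (fls_X_intpow n)) $$ (n + j)
      = (\<Sum>i=d..j-c. B (fls_X_intpow n) $$ (n + i) * A (fls_X_intpow (n + i)) $$ (n + i + (j - i)))" for n
  proof -
    have "order_ge (n + d) (B (fls_X_intpow n))"
      using filtered_order[OF B(1), of n "fls_X_intpow n"] by simp
    from filtered_nth[OF A(1) this, of "n + j"]
    have "A (B (fls_X_intpow n)) $$ (n + j)
        = (\<Sum>m=n+d..n+j-c. B (fls_X_intpow n) $$ m * A (fls_X_intpow m) $$ (n + j))" .
    also have "\<dots> = (\<Sum>i=d..j-c. B (fls_X_intpow n) $$ (n + i) * A (fls_X_intpow (n + i)) $$ (n + i + (j - i)))"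
      by (rule sum.reindex_bij_witness[of _ "\<lambda>i. n + i" "\<lambda>m. m - n"])
        (auto simp: add.commute)
    finally show ?thesis .
  qed
  have 1: "poly_fun (\<lambda>n. A (fls_X_intpow (n + i)) $$ (n + i + (j - i)))" for i
  proof (rule poly_fun_translate[of "\<lambda>n. A (fls_X_intpow n) $$ (n + (j - i))" i])
    show "poly_fun (\<lambda>n. A (fls_X_intpow n) $$ (n + (j - i)))"
      using A(2) unfolding polynomial_op_def by (rule spec)
  qed
  have 2: "poly_fun (\<lambda>n. B (fls_X_intpow n) $$ (n + i))" for i
    using B(2) unfolding polynomial_op_def by (rule spec)
  show "poly_fun (\<lambda>n. A (B (fls_X_intpow n)) $$ (n + j))"
    unfolding eq by (intro poly_fun_sum poly_fun_mult 1 2)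
qed

lemma polynomial_op_mult: "polynomial_op (\<lambda>v. f * v)"
  unfolding polynomial_op_def by (auto simp: fls_X_intpow_times_conv_shift)

lemma polynomial_op_diff:
  "polynomial_op A \<Longrightarrow> polynomial_op B \<Longrightarrow> polynomial_op (\<lambda>v. A v - B v)"
  unfolding polynomial_op_def by (auto intro: poly_fun_diff)

text \<open>
  A polynomial that vanishes at all multiples of \<open>s\<close> is zero. Hence relations between such operators
  over \<open>\<k>((u))\<close> need only be tested on the powers of \<open>u\<^sup>s\<close>.
\<close>

lemma polynomial_op_eq_0:
  fixes A :: "'a::field_char_0 fls \<Rightarrow> 'a fls"
  assumes "filtered c A" "polynomial_op A" "s > 0" "\<And>k. A (fls_X_intpow (int s * k)) = 0"
  shows "A v = 0"
proof -
  have "A (fls_X_intpow n) = 0" for n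
  proof (rule fls_zero_eqI)
    fix m
    have "poly_fun (\<lambda>i. A (fls_X_intpow i) $$ (i + (m - n)))"
      using assms(2) unfolding polynomial_op_def by (rule spec)
    moreover have "A (fls_X_intpow (int s * k)) $$ (int s * k + (m - n)) = 0" for k
      unfolding assms(4) by simp
    ultimately have "A (fls_X_intpow n) $$ (n + (m - n)) = 0"
      by (rule poly_fun_eq_0[OF _ assms(3)])
    then show "A (fls_X_intpow n) $$ m = 0" by simp
  qed
  moreover have "filtered 0 (\<lambda>v. 0 :: 'a fls)" by (simp add: filtered_def)
  ultimately show ?thesis using filtered_eqI[OF assms(1)] by metis
qed

section \<open>The automorphism \<open>\<phi>\<close> on Puiseux series\<close>

text \<open>
  The series \<open>(1 + u\<^sup>s)\<^sup>c\<close>. Since \<open>\<phi>\<close> sends \<open>u\<close> to \<open>u (1 + u\<^sup>s)\<^sup>-\<^sup>1\<^sup>/\<^sup>s\<close>, it sends \<open>u\<^sup>n\<close> to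
  \<open>u\<^sup>n (1 + u\<^sup>s)\<^sup>-\<^sup>n\<^sup>/\<^sup>s\<close>, whose coefficients are binomial coefficients and therefore polynomial in \<open>n\<close>.
\<close>

definition phi_factor :: "nat \<Rightarrow> 'a::field_char_0 \<Rightarrow> 'a fps" where
  "phi_factor s c = fps_compose (fps_binomial c) (fps_X ^ s)"

lemma phi_factor_0 [simp]: "s > 0 \<Longrightarrow> phi_factor s 0 = 1"
  by (simp add: phi_factor_def)

lemma phi_factor_add: "s > 0 \<Longrightarrow> phi_factor s (c + d) = phi_factor s c * phi_factor s d"
  by (simp add: phi_factor_def fps_binomial_add_mult fps_compose_mult_distrib)

lemma phi_factor_power: "s > 0 \<Longrightarrow> phi_factor s c ^ n = phi_factor s (of_nat n * c)"
  by (induction n) (simp_all add: phi_factor_add ring_distribs)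

lemma phi_factor_nth:
  "phi_factor s c $ n = (if s dvd n then c gchoose (n div s) else 0)"
  by (simp add: phi_factor_def fps_nth_compose_X_power)

lemma phi_factor_power_int:
  assumes "s > 0"
  shows "fps_to_fls (phi_factor s c) powi n = fps_to_fls (phi_factor s (of_int n * c))"
proof (cases "n \<ge> 0")
  case True
  then obtain m where n: "n = int m" using nonneg_int_cases by blast
  show ?thesis
    using assms by (simp add: n phi_factor_power flip: fps_to_fls_power)
next
  case False
  define m where "m = nat (- n)"
  have n: "n = - int m" using False by (simp add: m_def)
  have "fps_to_fls (phi_factor s (of_nat m * c)) * fps_to_fls (phi_factor s (- (of_nat m * c))) = 1"
    using assms by (simp flip: fls_times_fps_to_fls phi_factor_add)
  then have "inverse (fps_to_fls (phi_factor s (of_nat m * c))) = fps_to_fls (phi_factor s (- (of_nat m * c)))"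
    by (rule inverse_unique)
  then show ?thesis
    using assms by (simp add: n power_int_minus phi_factor_power flip: fps_to_fls_power)
qed

lemma phi_ext_alt: "phi_ext s v = fls_compose_fps v (fps_X * phi_factor s (- 1 / of_nat s))"
  by (simp add: phi_ext_def phi_factor_def)

lemma phi_ext_subst:
  assumes "s > 0"
  shows "(fps_X * phi_factor s c) $ 0 = 0" "(fps_X * phi_factor s c) $ 1 = 1"
    "fps_X * phi_factor s c \<noteq> 0"
proof -
  have 0: "phi_factor s c $ 0 = 1" using assms by (simp add: phi_factor_nth)
  show "(fps_X * phi_factor s c) $ 0 = 0" "(fps_X * phi_factor s c) $ 1 = 1"
    by (simp_all add: 0)
  then show "fps_X * phi_factor s c \<noteq> 0" by (metis fps_zero_nth one_neq_zero)
qed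

lemma exact_phi_ext: "s > 0 \<Longrightarrow> exact 0 (phi_ext s)"
  unfolding phi_ext_alt[abs_def]
  by (rule exact_compose_fps) (simp_all only: phi_ext_subst one_neq_zero not_False_eq_True)

lemma phi_ext_mult: "s > 0 \<Longrightarrow> phi_ext s (v * w) = phi_ext s v * phi_ext s w"
  unfolding phi_ext_alt by (intro fls_compose_fps_mult phi_ext_subst)

lemma phi_ext_X_intpow:
  fixes n :: int
  assumes "s > 0"
  shows "phi_ext s (fls_X_intpow n :: 'a::field_char_0 fls)
    = fls_X_intpow n * fps_to_fls (phi_factor s (- of_int n / of_nat s))"
proof -
  note S = phi_ext_subst[OF assms, of "- 1 / of_nat s :: 'a"]
  have "phi_ext s (fls_X_intpow n :: 'a fls)
      = fls_X powi n * fps_to_fls (phi_factor s (- 1 / of_nat s)) powi n"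
    unfolding phi_ext_alt fls_compose_fps_X_intpow[OF S(3,1)]
    by (simp only: fls_times_fps_to_fls fps_X_to_fls power_int_mult_distrib)
  then show ?thesis
    by (simp add: phi_factor_power_int[OF assms])
qed

lemma polynomial_op_phi_ext:
  assumes "s > 0"
  shows "polynomial_op (phi_ext s :: 'a::field_char_0 fls \<Rightarrow> 'a fls)"
  unfolding polynomial_op_def
proof
  fix j
  have *: "phi_ext s (fls_X_intpow n :: 'a fls) $$ (n + j)
    = (if j < 0 \<or> \<not> s dvd nat j then 0 else (of_int n * (- 1 / of_nat s)) gchoose (nat j div s))" for n
    by (auto simp: phi_ext_X_intpow[OF assms] fls_X_intpow_times_conv_shift phi_factor_nth)
  show "poly_fun (\<lambda>n. phi_ext s (fls_X_intpow n :: 'a fls) $$ (n + j))"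
    unfolding * by (cases "j < 0 \<or> \<not> s dvd nat j")
      (simp_all only: if_True if_False,
       intro poly_fun_const,
       intro poly_fun_gbinomial poly_fun_mult poly_fun_const poly_fun_of_int)
qed

lemma phi_ext_X_inv:
  assumes "s > 0"
  shows "phi_ext s (fls_X_intpow (- int s) * v) = (fls_X_intpow (- int s) + 1) * phi_ext s (v :: 'a::field_char_0 fls)"
proof -
  have "phi_factor s (1 :: 'a) = 1 + fps_X ^ s"
    using assms by (simp add: phi_factor_def fps_binomial_1 fps_compose_add_distrib)
  then have "fls_X_intpow (- int s) * fps_to_fls (phi_factor s (1::'a)) = fls_X_intpow (- int s) + 1"
    by (simp add: fps_to_fls_power fls_X_power_conv_shift_1 distrib_left fls_shift_1_times)
  then show ?thesis
    using phi_ext_X_intpow[OF assms, of "- int s", where ?'a = 'a] assms by (simp add: phi_ext_mult)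
qed

lemma phi_ext_compose_power:
  fixes h :: "'a::field_char_0 fls"
  assumes "s > 0"
  shows "phi_ext s (fls_compose_power h s) = fls_compose_power (phi h) s"
proof -
  note S = phi_ext_subst[OF assms, of "- 1 / of_nat s :: 'a"]
  have X: "(fps_X ^ s :: 'a fps) \<noteq> 0" "(fps_X ^ s :: 'a fps) $ 0 = 0" using assms by auto
  have Y: "(fps_X / (1 + fps_X) :: 'a fps) = fps_X * fps_binomial (- 1)"
    by (simp add: fps_binomial_minus_one fps_divide_unit)
  have Y0: "fps_X * fps_binomial (- 1) \<noteq> (0 :: 'a fps)" "(fps_X * fps_binomial (- 1) :: 'a fps) $ 0 = 0"
    by (auto intro!: fps_order1_nonzero)
  have "fps_X ^ s oo (fps_X * phi_factor s (- 1 / of_nat s)) = (fps_X * phi_factor s (- 1 / of_nat s)) ^ s"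
    using S(1) by (simp flip: fps_compose_power)
  also have "\<dots> = fps_X ^ s * phi_factor s (- 1)"
    using assms by (simp add: power_mult_distrib phi_factor_power)
  also have "\<dots> = (fps_X * fps_binomial (- 1)) oo fps_X ^ s"
    using assms by (simp add: phi_factor_def fps_compose_mult_distrib)
  finally show ?thesis
    unfolding fls_compose_power_conv_compose_fps[OF assms] phi_ext_alt phi_def Y
      fls_compose_fps_assoc[OF X S(3,1)] fls_compose_fps_assoc[OF Y0 X]
    by (rule arg_cong)
qed

section \<open>Polynomial solutions of difference equations\<close>

text \<open>
  For these products of linear factors the difference operator \<open>p(x) - p(x - s)\<close> acts like
  differentiation on powers, which makes them a convenient basis for inverting it.
\<close>

definition rising_product :: "'a::comm_ring_1 \<Rightarrow> nat \<Rightarrow> 'a poly" where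
  "rising_product s k = (\<Prod>i<k. [:of_nat i * s, 1:])"

lemma rising_product_difference:
  "poly (rising_product s (Suc k)) x - poly (rising_product s (Suc k)) (x - s)
    = of_nat (Suc k) * s * poly (rising_product s k) x"
proof -
  have "poly (rising_product s (Suc k)) (x - s) = (\<Prod>i<Suc k. of_nat i * s + (x - s))"
    by (simp add: rising_product_def poly_prod del: prod.lessThan_Suc)
  also have "\<dots> = (of_nat 0 * s + (x - s)) * (\<Prod>i<k. of_nat (Suc i) * s + (x - s))"
    by (rule prod.lessThan_Suc_shift)
  also have "\<dots> = (x - s) * (\<Prod>i<k. of_nat i * s + x)"
    by (simp add: algebra_simps)
  also have "(\<Prod>i<k. of_nat i * s + x) = poly (rising_product s k) x"
    by (simp add: rising_product_def poly_prod)
  finally have "poly (rising_product s (Suc k)) (x - s) = (x - s) * poly (rising_product s k) x" .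
  moreover have "poly (rising_product s (Suc k)) x = (of_nat k * s + x) * poly (rising_product s k) x"
    by (simp add: rising_product_def poly_prod algebra_simps)
  ultimately show ?thesis by (simp add: algebra_simps)
qed

text \<open>
  The induction over \<open>q\<close> peels off a factor \<open>x\<close>, and multiplication by \<open>x\<close> stays within the span of the
  products: \<open>x\<close> times the \<open>k\<close>-th one is the next one minus \<open>k s\<close> times it. The general \<open>k\<close> is
  needed for that step; the case of interest is \<open>k = 0\<close>, where the product is \<open>1\<close>.
\<close>

lemma antidifference_aux:
  fixes s :: "'a::field_char_0"
  assumes "s \<noteq> 0"
  shows "\<exists>p. poly p 0 = 0 \<and> (\<forall>x. poly p x - poly p (x - s) = poly (q * rising_product s k) x)"
proof (induction q arbitrary: k)
  case 0
  show ?case by (rule exI[of _ 0]) simp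
next
  case (pCons a q)
  obtain p1 where p1: "poly p1 0 = 0" "\<And>x. poly p1 x - poly p1 (x - s) = poly (q * rising_product s (Suc k)) x"
    using pCons.IH[of "Suc k"] by auto
  obtain p2 where p2: "poly p2 0 = 0" "\<And>x. poly p2 x - poly p2 (x - s) = poly (q * rising_product s k) x"
    using pCons.IH[of k] by auto
  define c where "c = a / (of_nat (Suc k) * s)"
  define p where "p = smult c (rising_product s (Suc k)) + p1 - smult (of_nat k * s) p2"
  have "poly (rising_product s (Suc k)) 0 = 0"
    unfolding rising_product_def by (subst prod.lessThan_Suc_shift) simp
  then have "poly p 0 = 0" by (simp add: p_def p1 p2)
  moreover have "poly p x - poly p (x - s) = poly (pCons a q * rising_product s k) x" for x
  proof -
    have "poly p x - poly p (x - s)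
        = c * (poly (rising_product s (Suc k)) x - poly (rising_product s (Suc k)) (x - s))
          + (poly p1 x - poly p1 (x - s)) - of_nat k * s * (poly p2 x - poly p2 (x - s))"
      by (simp add: p_def algebra_simps)
    also have "c * (poly (rising_product s (Suc k)) x - poly (rising_product s (Suc k)) (x - s))
        = a * poly (rising_product s k) x"
    proof -
      have "c * (of_nat (Suc k) * s) = a"
        unfolding c_def using assms by (simp del: of_nat_Suc)
      then show ?thesis
        unfolding rising_product_difference by (metis mult.assoc)
    qed
    also have "poly p1 x - poly p1 (x - s) = poly q x * (poly (rising_product s k) x * (of_nat k * s + x))"
      unfolding p1(2) by (simp add: rising_product_def algebra_simps)
    also have "poly p2 x - poly p2 (x - s) = poly q x * poly (rising_product s k) x"
      unfolding p2(2) by simp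
    finally show ?thesis by (simp add: algebra_simps)
  qed
  ultimately show ?case by blast
qed

definition antidifference :: "'a::field_char_0 \<Rightarrow> 'a poly \<Rightarrow> 'a poly" where
  "antidifference s q = (SOME p. poly p 0 = 0 \<and> (\<forall>x. poly p x - poly p (x - s) = poly q x))"

lemma antidifference:
  assumes "s \<noteq> 0"
  shows "poly (antidifference s q) 0 = 0"
    "poly (antidifference s q) x - poly (antidifference s q) (x - s) = poly q x"
proof -
  have "\<exists>p. poly p 0 = 0 \<and> (\<forall>x. poly p x - poly p (x - s) = poly q x)"
    using antidifference_aux[OF assms, of q 0] by (simp add: rising_product_def)
  from someI_ex[OF this]
  show "poly (antidifference s q) 0 = 0"
    "poly (antidifference s q) x - poly (antidifference s q) (x - s) = poly q x"
    unfolding antidifference_def by auto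
qed

section \<open>Diagonalizing the connection\<close>

text \<open>
  The coefficients of an operator \<open>H\<close> with \<open>H(u\<^sup>n) = u\<^sup>n \<Sum>\<^sub>j m\<^sub>j(n) u\<^sup>j\<close> that is to satisfy
  \<open>H u\<^sup>-\<^sup>s = (u\<^sup>-\<^sup>s - \<kappa> u d/du) H\<close>. Comparing coefficients on \<open>u\<^sup>n\<close> gives
  \<open>m\<^sub>j(n) - m\<^sub>j(n - s) = \<Sum>\<^sub>i \<kappa>\<^sub>j\<^sub>-\<^sub>s\<^sub>-\<^sub>i (n + i) m\<^sub>i(n)\<close>, a difference equation whose polynomial solution
  is unique once the constant term is chosen. The value for \<open>s = 0\<close> only serves termination.
\<close>

fun intertwiner_poly :: "nat \<Rightarrow> 'a::field_char_0 fps \<Rightarrow> nat \<Rightarrow> 'a poly" where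
  "intertwiner_poly s \<kappa> j = (if j = 0 \<or> s = 0 then 1 else if j < s then 0
     else antidifference (of_nat s) (\<Sum>i\<le>j - s. smult (\<kappa> $ (j - s - i)) ([:of_nat i, 1:] * intertwiner_poly s \<kappa> i)))"

declare intertwiner_poly.simps [simp del]

definition intertwiner_series :: "nat \<Rightarrow> 'a::field_char_0 fps \<Rightarrow> int \<Rightarrow> 'a fps" where
  "intertwiner_series s \<kappa> n = Abs_fps (\<lambda>j. poly (intertwiner_poly s \<kappa> j) (of_int n))"

lemma intertwiner_0 [simp]: "intertwiner_poly s \<kappa> 0 = 1"
  by (simp add: intertwiner_poly.simps)

lemma intertwiner_small: "0 < j \<Longrightarrow> j < s \<Longrightarrow> intertwiner_poly s \<kappa> j = 0"
  by (simp add: intertwiner_poly.simps)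

lemma intertwiner_difference:
  assumes "s > 0" "j \<ge> s"
  shows "poly (intertwiner_poly s \<kappa> j) x - poly (intertwiner_poly s \<kappa> j) (x - of_nat s)
    = (\<Sum>i\<le>j - s. \<kappa> $ (j - s - i) * ((x + of_nat i) * poly (intertwiner_poly s \<kappa> i) x))"
proof -
  have "intertwiner_poly s \<kappa> j
      = antidifference (of_nat s) (\<Sum>i\<le>j - s. smult (\<kappa> $ (j - s - i)) ([:of_nat i, 1:] * intertwiner_poly s \<kappa> i))"
    using assms by (subst intertwiner_poly.simps) auto
  then have "poly (intertwiner_poly s \<kappa> j) x - poly (intertwiner_poly s \<kappa> j) (x - of_nat s)
      = poly (\<Sum>i\<le>j - s. smult (\<kappa> $ (j - s - i)) ([:of_nat i, 1:] * intertwiner_poly s \<kappa> i)) x"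
    using antidifference(2)[of "of_nat s :: 'a"] assms(1) by (simp only: of_nat_eq_0_iff not_gr_zero)
  also have "\<dots> = (\<Sum>i\<le>j - s. \<kappa> $ (j - s - i) * ((x + of_nat i) * poly (intertwiner_poly s \<kappa> i) x))"
    unfolding poly_sum by (rule sum.cong) (simp_all only: poly_smult poly_mult poly_pCons poly_0 mult_1_right mult_zero_right add_0_right add.commute)
  finally show ?thesis .
qed

lemma intertwiner_at_0: "s > 0 \<Longrightarrow> poly (intertwiner_poly s \<kappa> s) 0 = 0"
  by (subst intertwiner_poly.simps) (simp add: antidifference(1))

text \<open>
  This value is the source of the correction term \<open>(r + s)/(2 s)\<close> in the theorem. The explicit
  quadratic polynomial solves the same difference equation and agrees at \<open>0\<close>, hence at all multiples
  of \<open>s\<close>, hence everywhere.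
\<close>

lemma intertwiner_leading:
  assumes "s > 0"
  shows "poly (intertwiner_poly s \<kappa> s) (of_int n) = \<kappa> $ 0 * (of_int n * (of_int n + of_nat s) / (2 * of_nat s))"
proof -
  \<comment> \<open>The difference to the claimed value is periodic with period \<open>s\<close> and vanishes at \<open>0\<close>.\<close>
  define c where "c = (\<lambda>n. poly (intertwiner_poly s \<kappa> s) (of_int n) - \<kappa> $ 0 * (of_int n * (of_int n + of_nat s) * (1 / (2 * of_nat s))))"
  have "poly_fun c"
    unfolding c_def
    by (intro poly_fun_diff poly_fun_mult poly_fun_add poly_fun_const poly_fun_of_int poly_fun_poly)
  moreover have step: "c n = c (n - int s)" for n
  proof -
    have "poly (intertwiner_poly s \<kappa> s) (of_int n) - poly (intertwiner_poly s \<kappa> s) (of_int n - of_nat s) = \<kappa> $ 0 * of_int n"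
      using intertwiner_difference[OF assms order_refl, of \<kappa> "of_int n"] by simp
    then show ?thesis
      unfolding c_def using assms by (simp add: field_simps)
  qed
  moreover have "c (int s * k) = 0" for k
  proof (induction k rule: int_induct[where k = 0])
    case base
    show ?case by (simp add: c_def intertwiner_at_0 assms)
  next
    case (step1 i)
    then show ?case using step[of "int s * (i + 1)"] by (simp add: algebra_simps)
  next
    case (step2 i)
    then show ?case using step[of "int s * i"] by (simp add: algebra_simps)
  qed
  ultimately have "c n = 0" using poly_fun_eq_0[OF _ assms] by blast
  then show ?thesis by (simp add: c_def)
qed

lemma intertwiner_series_difference:
  assumes "s > 0"
  shows "intertwiner_series s \<kappa> n - fps_X ^ s * (\<kappa> * Abs_fps (\<lambda>i. (of_int n + of_nat i) * intertwiner_series s \<kappa> n $ i))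
    = intertwiner_series s \<kappa> (n - int s)"
proof (rule fps_ext)
  fix j
  show "(intertwiner_series s \<kappa> n - fps_X ^ s * (\<kappa> * Abs_fps (\<lambda>i. (of_int n + of_nat i) * intertwiner_series s \<kappa> n $ i))) $ j
    = intertwiner_series s \<kappa> (n - int s) $ j"
  proof (cases "j < s")
    case True
    then show ?thesis
      by (cases "j = 0") (simp_all add: intertwiner_series_def intertwiner_small fps_X_power_mult_nth)
  next
    case False
    have "(\<kappa> * Abs_fps (\<lambda>i. (of_int n + of_nat i) * intertwiner_series s \<kappa> n $ i)) $ (j - s)
      = (\<Sum>i\<le>j - s. \<kappa> $ (j - s - i) * ((of_int n + of_nat i) * poly (intertwiner_poly s \<kappa> i) (of_int n)))"
      unfolding mult.commute[of \<kappa>] fps_mult_nth atLeast0AtMost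
      by (rule sum.cong) (simp_all add: intertwiner_series_def)
    then show ?thesis
      using intertwiner_difference[OF assms, of j \<kappa> "of_int n"] False
      by (simp add: fps_X_power_mult_nth) (simp add: intertwiner_series_def algebra_simps)
  qed
qed

lemma fls_X_times_deriv_nth: "(fls_X * fls_deriv v) $$ n = of_int n * v $$ n" for v :: "'a::field fls"
  by (simp add: fls_X_times_conv_shift)

text \<open>
  The operator \<open>- z \<nabla>\<close> of \<open>E\<^sub>f\<close> in the coordinate \<open>u\<close> with \<open>f = - u\<^sup>-\<^sup>s\<close>, where \<open>z d/dz = \<kappa> u d/du\<close>.
\<close>

definition minus_z_nabla :: "nat \<Rightarrow> 'a::field fps \<Rightarrow> 'a fls \<Rightarrow> 'a fls" where
  "minus_z_nabla s \<kappa> v = fls_X_intpow (- int s) * v - fps_to_fls \<kappa> * (fls_X * fls_deriv v)"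

lemma filtered_euler: "filtered 0 (\<lambda>v. fps_to_fls \<kappa> * (fls_X * fls_deriv v))"
proof -
  have X: "order_ge 1 (fls_X :: 'a::field fls)" by (auto simp: order_ge_def)
  show ?thesis
    using filtered_comp[OF filtered_mult[OF order_ge_fps[of \<kappa>]] filtered_comp[OF filtered_mult[OF X] filtered_deriv]]
    by simp
qed

lemma filtered_minus_z_nabla: "filtered (- int s) (minus_z_nabla s \<kappa>)"
  unfolding minus_z_nabla_def[abs_def]
  by (intro filtered_fun_diff filtered_mult filtered_mono[OF filtered_euler]) simp_all

text \<open>
  The operator \<open>H\<close> is the change of basis that turns \<open>- z \<nabla>\<close> into multiplication by \<open>u\<^sup>-\<^sup>s = \<theta>\<^sup>-\<^sup>1\<close>.
  The last two properties record its expansion up to relative order \<open>s\<close>: it is the identity plus an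
  explicit term of degree \<open>s\<close>, which is all that influences the class of \<open>g\<close>.
\<close>

lemma intertwiner_exists:
  fixes \<kappa> :: "'a::field_char_0 fps"
  assumes s: "s > 0"
  obtains H where "filtered 0 H" "polynomial_op H"
    "\<And>v. H (fls_X_intpow (- int s) * v) = minus_z_nabla s \<kappa> (H v)"
    "filtered (int s) (\<lambda>v. H v - v)"
    "\<And>n. H (fls_X_intpow n) $$ (n + int s) = \<kappa> $ 0 * (of_int n * (of_int n + of_nat s) / (2 * of_nat s))"
proof -
  let ?M = "\<lambda>n. fls_X_intpow n * fps_to_fls (intertwiner_series s \<kappa> n)"
  have M_nth: "?M n $$ (n + j) = (if j < 0 then 0 else poly (intertwiner_poly s \<kappa> (nat j)) (of_int n))" for n j
    by (simp add: fls_shift_1_times intertwiner_series_def)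
  have M: "order_ge n (?M n)" for n
    by (simp add: order_ge_def fls_shift_1_times)
  obtain H where H: "filtered 0 H" and HX: "\<And>n. H (fls_X_intpow n) = ?M n"
    by (rule filtered_exists[of ?M, OF M]) blast
  show thesis
  proof
    show "filtered 0 H" by fact
    show "polynomial_op H"
      unfolding polynomial_op_def
    proof
      fix j
      show "poly_fun (\<lambda>n. H (fls_X_intpow n) $$ (n + j))"
        unfolding HX M_nth by (cases "j < 0") (auto simp only: if_True if_False)
    qed
    show "H (fls_X_intpow (- int s) * v) = minus_z_nabla s \<kappa> (H v)" for v
    proof (rule filtered_eqI[where A = "\<lambda>v. H (fls_X_intpow (- int s) * v)" and B = "\<lambda>v. minus_z_nabla s \<kappa> (H v)"])
      have "order_ge (- int s) (fls_X_intpow (- int s) :: 'a fls)" by simp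
      from filtered_comp[OF H filtered_mult[OF this]]
      show "filtered (0 + - int s) (\<lambda>v. H (fls_X_intpow (- int s) * v))" .
      show "filtered (- int s + 0) (\<lambda>v. minus_z_nabla s \<kappa> (H v))"
        by (rule filtered_comp[OF filtered_minus_z_nabla H])
      fix n
      let ?D = "Abs_fps (\<lambda>i. (of_int n + of_nat i) * intertwiner_series s \<kappa> n $ i)"
      have "fls_X * fls_deriv (?M n) = fls_X_intpow n * fps_to_fls ?D"
      proof (rule fls_eqI)
        fix m
        have "(of_nat (nat (m - n)) :: 'a) = of_int m - of_int n" if "m \<ge> n"
          using that of_int_of_nat_eq[of "nat (m - n)", where ?'a = 'a] by simp
        then show "(fls_X * fls_deriv (?M n)) $$ m = (fls_X_intpow n * fps_to_fls ?D) $$ m"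
          unfolding fls_X_times_deriv_nth fls_shift_1_times by simp
      qed
      then have "minus_z_nabla s \<kappa> (?M n)
          = fls_X_intpow (n - int s) * (fps_to_fls (intertwiner_series s \<kappa> n) - fls_X_intpow (int s) * (fps_to_fls \<kappa> * fps_to_fls ?D))"
        by (simp add: minus_z_nabla_def right_diff_distrib fls_shift_1_times fls_shifted_times_simps)
      also have "fps_to_fls (intertwiner_series s \<kappa> n) - fls_X_intpow (int s) * (fps_to_fls \<kappa> * fps_to_fls ?D)
          = fps_to_fls (intertwiner_series s \<kappa> n - fps_X ^ s * (\<kappa> * ?D))"
        by (simp add: fls_times_fps_to_fls fps_to_fls_power fls_X_power_conv_shift_1)
      also have "\<dots> = fps_to_fls (intertwiner_series s \<kappa> (n - int s))"
        by (simp only: intertwiner_series_difference[OF s])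
      finally show "H (fls_X_intpow (- int s) * fls_X_intpow n) = minus_z_nabla s \<kappa> (H (fls_X_intpow n))"
        unfolding HX fls_X_intpow_times_fls_X_intpow by (simp add: HX)
    qed
    show "filtered (int s) (\<lambda>v. H v - v)"
    proof (rule filtered_raise)
      show "filtered 0 (\<lambda>v. H v - v)"
        using filtered_fun_diff[OF H filtered_mult[of 0 1]] by (simp add: order_ge_def)
      fix n
      have "(?M n - fls_X_intpow n) $$ (n + j) = 0" if "j < int s" for j
        using that unfolding fls_minus_nth M_nth by (auto simp: intertwiner_small)
      then have "(?M n - fls_X_intpow n) $$ i = 0" if "i < n + int s" for i
        using that by (metis add_diff_cancel_left' add.commute diff_add_cancel less_diff_eq diff_less_eq)
      then show "order_ge (n + int s) (H (fls_X_intpow n) - fls_X_intpow n)"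
        unfolding HX order_ge_def by blast
    qed
    show "H (fls_X_intpow n) $$ (n + int s) = \<kappa> $ 0 * (of_int n * (of_int n + of_nat s) / (2 * of_nat s))" for n
      unfolding HX M_nth using intertwiner_leading[OF s, of \<kappa> n] by simp
  qed
qed

section \<open>The connection as a difference operator\<close>

lemma exact_mult: "order_ge c f \<Longrightarrow> f $$ c \<noteq> 0 \<Longrightarrow> exact c (\<lambda>v. f * v)"
  by (simp add: exact_def filtered_mult fls_X_intpow_times_conv_shift)

text \<open>
  The relation \<open>z (- z \<nabla>) = (- z \<nabla> + 1) z\<close>: the hypothesis says that \<open>z d/dz\<close> fixes the series \<open>Z\<close>
  which represents \<open>z\<close>.
\<close>

lemma minus_z_nabla_mult:
  assumes "fps_to_fls \<kappa> * (fls_X * fls_deriv Z) = Z"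
  shows "Z * minus_z_nabla s \<kappa> y = minus_z_nabla s \<kappa> (Z * y) + Z * y"
proof -
  have eq: "minus_z_nabla s \<kappa> (Z * y) = fls_X_intpow (- int s) * (Z * y)
      - (fps_to_fls \<kappa> * (fls_X * fls_deriv Z) * y + Z * (fps_to_fls \<kappa> * (fls_X * fls_deriv y)))"
    unfolding minus_z_nabla_def by (simp add: algebra_simps)
  show ?thesis
    unfolding eq assms by (simp add: minus_z_nabla_def algebra_simps)
qed

lemma exact_minus_z_nabla_plus:
  assumes "s > 0"
  shows "exact (- int s) (\<lambda>v. minus_z_nabla s \<kappa> v + v)"
proof -
  have "filtered (- int s) (\<lambda>v :: 'a fls. v)"
    by (auto simp: filtered_def intro: order_ge_mono)
  from filtered_fun_add[OF filtered_minus_z_nabla this]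
  have "filtered (- int s) (\<lambda>v. minus_z_nabla s \<kappa> v + v)" .
  moreover have "(minus_z_nabla s \<kappa> (fls_X_intpow n) + fls_X_intpow n) $$ (n + - int s) \<noteq> 0" for n
  proof -
    have "order_ge (n + 0) (fps_to_fls \<kappa> * (fls_X * fls_deriv (fls_X_intpow n)))"
      by (rule filtered_order[OF filtered_euler]) simp
    then have "(fps_to_fls \<kappa> * (fls_X * fls_deriv (fls_X_intpow n))) $$ (n + - int s) = 0"
      using assms by (auto simp: order_ge_def)
    then show ?thesis
      using assms by (simp add: minus_z_nabla_def fls_shift_1_times)
  qed
  ultimately show ?thesis by (simp add: exact_def)
qed

text \<open>
  The heart of the proof. The intertwiner \<open>H\<close> may be composed with multiplication by any unit \<open>w\<close>,
  because this commutes with \<open>u\<^sup>-\<^sup>s\<close>. The series \<open>w\<close> is chosen so that \<open>Z H(w) = H(g w)\<close>, that is, so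
  that the relation \<open>z = g \<phi>\<close> holds on the vector \<open>1\<close>. Both sides of \<open>Z H(w v) = H(w g \<phi>(v))\<close> obey the
  same commutation rule with \<open>u\<^sup>-\<^sup>s\<close>, so that the relation spreads from \<open>1\<close> to all powers of \<open>u\<^sup>s\<close>,
  and polynomiality of the coefficients then spreads it to all powers of \<open>u\<close>. The hypothesis on \<open>\<kappa>\<close>
  says that \<open>z d/dz = \<kappa> u d/du\<close> for \<open>z = T\<^sup>r\<close>.
\<close>

lemma difference_model:
  fixes T \<kappa> :: "'a::field_char_0 fps"
  assumes s: "s > 0" and r: "r > 0" and T0: "T $ 0 = 0" and T1: "T $ 1 = b" "b \<noteq> 0"
    and \<kappa>: "\<kappa> * (fps_X * fps_deriv T) = fps_const (1 / of_nat r) * T"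
    and g: "g = fps_to_fls (T ^ r) - fls_const (b ^ r * (of_nat (r + s) / of_nat (2 * s))) * fls_X ^ (s + r)"
  obtains K where "exact 0 K"
    "\<And>v. K (fls_X_intpow (- int s) * v) = minus_z_nabla s \<kappa> (K v)"
    "\<And>v. fps_to_fls (T ^ r) * K v = K (g * phi_ext s v)"
proof -
  define Z where "Z = fps_to_fls (T ^ r)"
  have \<kappa>0: "\<kappa> $ 0 = 1 / of_nat r"
  proof -
    have "(\<kappa> * (fps_X * fps_deriv T)) $ 1 = \<kappa> $ 0 * b"
      using T1 by (simp add: fps_mult_nth_1)
    then have "\<kappa> $ 0 * b = 1 / of_nat r * b" unfolding \<kappa> using T1 by simp
    then show ?thesis using T1(2) by (simp only: mult_cancel_right) simp
  qed
  have Z_eq: "fps_to_fls \<kappa> * (fls_X * fls_deriv Z) = Z"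
  proof -
    have "\<kappa> * (fps_X * fps_deriv (T ^ r)) = fps_const (of_nat r) * (\<kappa> * (fps_X * fps_deriv T)) * T ^ (r - 1)"
      by (simp add: fps_deriv_power mult_ac)
    also have "\<dots> = (fps_const (of_nat r) * fps_const (1 / of_nat r)) * (T * T ^ (r - 1))"
      unfolding \<kappa> by (simp only: mult_ac)
    also have "\<dots> = T ^ r"
      using r by (simp add: power_eq_if[of T r])
    finally have "fps_to_fls (\<kappa> * (fps_X * fps_deriv (T ^ r))) = fps_to_fls (T ^ r)" by simp
    then show ?thesis
      by (simp add: Z_def fls_deriv_fps_to_fls fls_times_fps_to_fls)
  qed
  have Z_ord: "order_ge (int r) Z"
    unfolding Z_def order_ge_def using startsby_zero_power_prefix[OF T0] by auto
  have Z_lead: "Z $$ int r = b ^ r"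
    unfolding Z_def using startsby_zero_power_nth_same[OF T0] T1 by simp
  have g': "Z - g = fls_const (b ^ r * (of_nat (r + s) / of_nat (2 * s))) * fls_X_intpow (int r + int s)"
    unfolding g Z_def by (simp add: fls_X_power_conv_shift_1 add.commute)
  have Zg_ord: "order_ge (int r + int s) (Z - g)"
    unfolding g' by (intro order_ge_const_mult) simp
  have Zg_lead: "(Z - g) $$ (int r + int s) = b ^ r * (of_nat (r + s) / of_nat (2 * s))"
    unfolding g' by (simp add: fls_shift_1_times)
  have "order_ge (int r) (Z - (Z - g))"
    using order_ge_diff[OF Z_ord order_ge_mono[OF Zg_ord]] by simp
  then have g_ord: "order_ge (int r) g" by simp
  have "(Z - g) $$ int r = 0"
    using Zg_ord s by (auto simp: order_ge_def)
  then have g_lead: "g $$ int r = b ^ r"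
    using Z_lead by simp
  obtain H where H: "filtered 0 H" "polynomial_op H"
    and H_shift: "\<And>v. H (fls_X_intpow (- int s) * v) = minus_z_nabla s \<kappa> (H v)"
    and E: "filtered (int s) (\<lambda>v. H v - v)"
    and E_lead: "\<And>n. H (fls_X_intpow n) $$ (n + int s) = \<kappa> $ 0 * (of_int n * (of_int n + of_nat s) / (2 * of_nat s))"
    by (rule intertwiner_exists[OF s, of \<kappa>]) blast
  define e where "e = (\<lambda>x::'a. x * (x + of_nat s) / (2 * of_nat s * of_nat r))"
  have E_lead': "(H (fls_X_intpow n) - fls_X_intpow n) $$ (n + int s) = e (of_int n)" for n
    unfolding fls_minus_nth E_lead \<kappa>0 e_def using s by simp
  \<comment> \<open>The equation for \<open>w\<close> is \<open>L w = 0\<close>. The terms of degree \<open>r\<close> cancel, so \<open>L\<close> has degree \<open>r + s\<close>.\<close>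
  define L where "L = (\<lambda>v. Z * H v - H (g * v))"
  have L_eq: "L v = (Z - g) * v + Z * (H v - v) - (H (g * v) - g * v)" for v
    by (simp add: L_def algebra_simps)
  have L: "filtered (int r + int s) L"
  proof -
    have 1: "filtered (int r + int s) (\<lambda>v. (Z - g) * v)"
      by (rule filtered_mult[OF Zg_ord])
    have 2: "filtered (int r + int s) (\<lambda>v. Z * (H v - v))"
      by (rule filtered_comp[OF filtered_mult[OF Z_ord] E])
    have 3: "filtered (int r + int s) (\<lambda>v. H (g * v) - g * v)"
      using filtered_comp[OF E filtered_mult[OF g_ord]] by (simp add: add.commute)
    show ?thesis
      using filtered_fun_diff[OF filtered_fun_add[OF 1 2] 3] by (simp add: L_eq[abs_def])
  qed
  have L_lead: "L (fls_X_intpow n) $$ (n + (int r + int s)) = - (b ^ r * of_int n / of_nat s)" for n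
  proof -
    have X: "order_ge n (fls_X_intpow n :: 'a fls)" by simp
    have 1: "((Z - g) * fls_X_intpow n) $$ (n + (int r + int s)) = b ^ r * (of_nat (r + s) / of_nat (2 * s))"
      using fls_times_nth_leading[OF Zg_ord X] unfolding Zg_lead by (simp add: add.commute)
    have "order_ge (n + int s) (H (fls_X_intpow n) - fls_X_intpow n)"
      by (rule filtered_order[OF E X])
    from fls_times_nth_leading[OF Z_ord this]
    have 2: "(Z * (H (fls_X_intpow n) - fls_X_intpow n)) $$ (n + (int r + int s)) = b ^ r * e (of_int n)"
      unfolding Z_lead E_lead' by (simp add: add_ac)
    have gX: "order_ge (n + int r) (g * fls_X_intpow n)"
      using order_ge_mult[OF g_ord X] by (simp add: add.commute)
    have "(g * fls_X_intpow n) $$ (n + int r) = b ^ r"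
      using fls_times_nth_leading[OF g_ord X] g_lead by (simp add: add.commute)
    then have 3: "(H (g * fls_X_intpow n) - g * fls_X_intpow n) $$ (n + (int r + int s)) = b ^ r * e (of_int (n + int r))"
      using filtered_nth_leading[OF E gX] unfolding E_lead' by (simp only: add.assoc)
    have "L (fls_X_intpow n) $$ (n + (int r + int s))
        = b ^ r * (of_nat (r + s) / of_nat (2 * s)) + b ^ r * e (of_int n) - b ^ r * e (of_int (n + int r))"
      unfolding L_eq fls_minus_nth[of "_ + _"] fls_plus_nth 1 2 3 ..
    also have "\<dots> = - (b ^ r * of_int n / of_nat s)"
      using r s by (simp add: e_def field_simps)
    finally show ?thesis .
  qed
  \<comment> \<open>The choice of the constant in \<open>g\<close> is exactly what makes the leading coefficient vanish at \<open>n = 0\<close>.\<close>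
  have L1: "order_ge (1 + (int r + int s)) (- L 1)"
  proof -
    have "order_ge (0 + (int r + int s)) (L 1)"
      by (rule filtered_order[OF L]) (simp add: order_ge_def)
    moreover have "L 1 $$ (0 + (int r + int s)) = 0"
      using L_lead[of 0] by simp
    ultimately have "order_ge (0 + (int r + int s) + 1) (L 1)" by (rule order_ge_Suc)
    then show ?thesis by (intro order_ge_uminus) (simp add: add_ac)
  qed
  have "L (fls_X_intpow n) $$ (n + (int r + int s)) \<noteq> 0" if "n \<ge> 1" for n
    unfolding L_lead using that T1 s by simp
  then obtain v where v: "order_ge 1 v" "L v = - L 1"
    by (rule filtered_solve[OF L _ L1])
  define w where "w = 1 + v"
  have w0: "order_ge 0 w" "w $$ 0 \<noteq> 0"
    using v(1) by (auto simp: w_def order_ge_def)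
  have "L w = 0" using v(2) by (simp add: w_def filtered_add[OF L])
  then have w: "Z * H w = H (g * w)" by (simp add: L_def)
  have H_exact: "exact 0 H"
  proof -
    have "(H (fls_X_intpow n) - fls_X_intpow n) $$ n = 0" for n
      using filtered_order[OF E, of n "fls_X_intpow n"] s by (auto simp: order_ge_def)
    then have "H (fls_X_intpow n) $$ n = fls_X_intpow n $$ n" for n
      by simp
    then show ?thesis using H by (simp add: exact_def)
  qed
  \<comment> \<open>The defect of the relation \<open>z = g \<phi>\<close>.\<close>
  define A where "A = (\<lambda>v. Z * H (w * v) - H (w * (g * phi_ext s v)))"
  have phi: "filtered 0 (phi_ext s :: 'a fls \<Rightarrow> 'a fls)"
    by (rule exact_filtered[OF exact_phi_ext[OF s]])
  have A_filtered: "filtered (int r) A"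
  proof -
    have 1: "filtered (int r + (0 + 0)) (\<lambda>v. Z * H (w * v))"
      by (rule filtered_comp[OF filtered_mult[OF Z_ord] filtered_comp[OF H(1) filtered_mult[OF w0(1)]]])
    have 2: "filtered (0 + (0 + (int r + 0))) (\<lambda>v. H (w * (g * phi_ext s v)))"
      by (rule filtered_comp[OF H(1) filtered_comp[OF filtered_mult[OF w0(1)] filtered_comp[OF filtered_mult[OF g_ord] phi]]])
    show ?thesis
      using filtered_fun_diff[of "int r"] 1 2 by (simp add: A_def)
  qed
  have A_poly: "polynomial_op A"
  proof -
    note Hw = filtered_comp[OF H(1) filtered_mult[OF w0(1)]]
    note Hw_poly = polynomial_op_comp[OF H filtered_mult[OF w0(1)] polynomial_op_mult]
    note g_phi = filtered_comp[OF filtered_mult[OF g_ord] phi]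
    note g_phi_poly = polynomial_op_comp[OF filtered_mult[OF g_ord] polynomial_op_mult phi polynomial_op_phi_ext[OF s]]
    show ?thesis
      unfolding A_def
      by (rule polynomial_op_diff[OF polynomial_op_comp[OF filtered_mult[OF Z_ord] polynomial_op_mult Hw Hw_poly]
            polynomial_op_comp[OF Hw Hw_poly g_phi g_phi_poly]])
  qed
  have A_shift: "A (fls_X_intpow (- int s) * v) = minus_z_nabla s \<kappa> (A v) + A v" for v
  proof -
    have "Z * H (w * (fls_X_intpow (- int s) * v)) = Z * minus_z_nabla s \<kappa> (H (w * v))"
      by (simp only: mult.left_commute[of w] H_shift)
    also have "\<dots> = minus_z_nabla s \<kappa> (Z * H (w * v)) + Z * H (w * v)"
      by (rule minus_z_nabla_mult[OF Z_eq])
    finally have 1: "Z * H (w * (fls_X_intpow (- int s) * v)) = minus_z_nabla s \<kappa> (Z * H (w * v)) + Z * H (w * v)" .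
    let ?y = "w * (g * phi_ext s v)"
    have "w * (g * phi_ext s (fls_X_intpow (- int s) * v)) = fls_X_intpow (- int s) * ?y + ?y"
      unfolding phi_ext_X_inv[OF s] by (simp add: algebra_simps)
    then have 2: "H (w * (g * phi_ext s (fls_X_intpow (- int s) * v))) = minus_z_nabla s \<kappa> (H ?y) + H ?y"
      by (simp only: filtered_add[OF H(1)] H_shift)
    show ?thesis
      unfolding A_def 1 2 filtered_diff[OF filtered_minus_z_nabla] by simp
  qed
  have N_inj: "minus_z_nabla s \<kappa> y + y = 0 \<Longrightarrow> y = 0" for y
    using exact_bij[OF exact_minus_z_nabla_plus[OF s, of \<kappa>]]
      filtered_0[OF exact_filtered[OF exact_minus_z_nabla_plus[OF s, of \<kappa>]]]
    unfolding bij_def inj_def by metis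
  \<comment> \<open>The operator \<open>- z \<nabla> + 1\<close> is injective, so \<open>A_shift\<close> can be used to go up as well as down.\<close>
  have A_zero: "A (fls_X_intpow (int s * k)) = 0" for k
  proof (induction k rule: int_induct[where k = 0])
    case base
    have "phi_ext s (1 :: 'a fls) = 1" by (simp add: phi_ext_def)
    then show ?case using w by (simp add: A_def mult.commute)
  next
    case (step1 k)
    have eq: "fls_X_intpow (- int s) * fls_X_intpow (int s * (k + 1)) = (fls_X_intpow (int s * k) :: 'a fls)"
      unfolding fls_X_intpow_times_fls_X_intpow by (simp add: algebra_simps)
    show ?case
      by (rule N_inj) (use A_shift[of "fls_X_intpow (int s * (k + 1))", unfolded eq step1(2)] in \<open>rule sym\<close>)
  next
    case (step2 k)
    have eq: "fls_X_intpow (- int s) * fls_X_intpow (int s * k) = (fls_X_intpow (int s * (k - 1)) :: 'a fls)"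
      unfolding fls_X_intpow_times_fls_X_intpow by (simp add: algebra_simps)
    show ?case
      using A_shift[of "fls_X_intpow (int s * k)"]
      unfolding eq step2(2) filtered_0[OF filtered_minus_z_nabla] by simp
  qed
  have A0: "A v = 0" for v
    by (rule polynomial_op_eq_0[OF A_filtered A_poly s A_zero])
  show thesis
  proof
    show "exact 0 (\<lambda>v. H (w * v))"
      using exact_comp[OF H_exact exact_mult[OF w0]] by simp
    show "H (w * (fls_X_intpow (- int s) * v)) = minus_z_nabla s \<kappa> (H (w * v))" for v
      by (simp only: mult.left_commute[of w] H_shift)
    show "fps_to_fls (T ^ r) * H (w * v) = H (w * (g * phi_ext s v))" for v
      using A0[of v] by (simp add: A_def Z_def)
  qed
qed

text \<open>
  The operator \<open>z \<nabla>\<close> of \<open>E\<^sub>f\<close>, written in the variable \<open>t = z\<^sup>1\<^sup>/\<^sup>r\<close>.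
\<close>

definition euler_connection :: "nat \<Rightarrow> 'a::field_char_0 fls \<Rightarrow> 'a fls \<Rightarrow> 'a fls" where
  "euler_connection r f v = fls_const (1 / of_nat r) * (fls_X * fls_deriv v) + f * v"

text \<open>
  Substituting \<open>t = T(u)\<close> identifies \<open>\<k>((t))\<close> with \<open>\<k>((u))\<close>, turns \<open>f\<close> into \<open>- u\<^sup>-\<^sup>s\<close> and \<open>z = t\<^sup>r\<close> into \<open>T\<^sup>r\<close>;
  the operator \<open>G\<close> is the model of the previous lemma followed by the inverse of this identification.
\<close>

lemma mellin_model:
  fixes T :: "'a::field_char_0 fps"
  assumes s: "s > 0" and r: "r > 0" and T0: "T $ 0 = 0" and T1: "T $ 1 = b" "b \<noteq> 0"
    and g: "g = fps_to_fls (T ^ r) - fls_const (b ^ r * (of_nat (r + s) / of_nat (2 * s))) * fls_X ^ (s + r)"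
    and f: "fls_compose_fps f T = - fls_X_intpow (- int s)"
  obtains G where "exact 0 G"
    "\<And>v. euler_connection r f (G v) = - G (fls_X_intpow (- int s) * v)"
    "\<And>v. fls_X_intpow (int r) * G v = G (g * phi_ext s v)"
proof -
  define \<kappa> where "\<kappa> = fps_const (1 / of_nat r) * (fps_shift 1 T * inverse (fps_deriv T))"
  have T': "fps_deriv T * inverse (fps_deriv T) = 1"
    using T1 inverse_mult_eq_1'[of "fps_deriv T"] by simp
  have XT: "fps_X * fps_shift 1 T = T"
    by (rule fps_ext) (simp add: T0)
  have \<kappa>: "\<kappa> * (fps_X * fps_deriv T) = fps_const (1 / of_nat r) * T"
  proof -
    have "\<kappa> * (fps_X * fps_deriv T)
        = fps_const (1 / of_nat r) * (fps_X * fps_shift 1 T) * (fps_deriv T * inverse (fps_deriv T))"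
      by (simp add: \<kappa>_def mult_ac)
    then show ?thesis by (simp only: T' XT mult_1_right)
  qed
  obtain K where K: "exact 0 K"
    and K_shift: "\<And>v. K (fls_X_intpow (- int s) * v) = minus_z_nabla s \<kappa> (K v)"
    and K_g: "\<And>v. fps_to_fls (T ^ r) * K v = K (g * phi_ext s v)"
    by (rule difference_model[OF s r T0 T1 \<kappa> g]) blast
  define C where "C = (\<lambda>v. fls_compose_fps v T)"
  have T1': "T $ 1 \<noteq> 0" using T1 by simp
  note Tnz = fps_order1_nonzero[OF T1']
  have C: "exact 0 C" unfolding C_def by (rule exact_compose_fps[OF T0 T1'])
  have bij: "bij C" by (rule exact_bij[OF C])
  have CI: "C (inv C v) = v" for v using bij by (simp add: bij_is_surj surj_f_inv_f)
  have IC: "inv C (C v) = v" for v using bij by (simp add: bij_is_inj)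
  have CI_exact: "exact 0 (inv C)" using exact_inv[OF C] by simp
  have C_conn: "C (euler_connection r f v) = - minus_z_nabla s \<kappa> (C v)" for v
  proof -
    have 1: "C (fls_const (1 / of_nat r) * (fls_X * fls_deriv v)) = fps_to_fls \<kappa> * (fls_X * fls_deriv (C v))"
    proof -
      have "fps_to_fls \<kappa> * (fls_X * fls_deriv (C v))
          = fps_to_fls (\<kappa> * (fps_X * fps_deriv T)) * C (fls_deriv v)"
        unfolding C_def fls_deriv_compose_fps[OF T0 T1'] fls_deriv_fps_to_fls
        by (simp add: fls_times_fps_to_fls mult_ac)
      also have "\<dots> = C (fls_const (1 / of_nat r) * (fls_X * fls_deriv v))"
        unfolding \<kappa> C_def by (simp add: fls_times_fps_to_fls fls_compose_fps_mult Tnz T0)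
      finally show ?thesis ..
    qed
    have 2: "C (f * v) = - (fls_X_intpow (- int s) * C v)"
      unfolding C_def fls_compose_fps_mult[OF Tnz T0] f by simp
    show ?thesis
      unfolding euler_connection_def filtered_add[OF exact_filtered[OF C]] 1 2
      by (simp add: minus_z_nabla_def)
  qed
  have C_X: "C (fls_X_intpow (int r) * v) = fps_to_fls (T ^ r) * C v" for v
    unfolding C_def fls_compose_fps_mult[OF Tnz T0] fls_compose_fps_X_intpow[OF Tnz T0]
    by (simp add: fps_to_fls_power)
  show thesis
  proof
    show "exact 0 (\<lambda>v. inv C (K v))" using exact_comp[OF CI_exact K] by simp
    show "euler_connection r f (inv C (K v)) = - inv C (K (fls_X_intpow (- int s) * v))" for v
    proof -
      have "euler_connection r f (inv C (K v)) = inv C (- minus_z_nabla s \<kappa> (K v))"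
        using C_conn[of "inv C (K v)"] unfolding CI by (metis IC)
      then show ?thesis
        by (simp only: K_shift filtered_uminus[OF exact_filtered[OF CI_exact]])
    qed
    show "fls_X_intpow (int r) * inv C (K v) = inv C (K (g * phi_ext s v))" for v
      using C_X[of "inv C (K v)"] unfolding CI K_g by (metis IC)
  qed
qed

section \<open>Puiseux series as a vector space\<close>

definition subfield_scale :: "nat \<Rightarrow> 'a::field fls \<Rightarrow> 'a fls \<Rightarrow> 'a fls" where
  "subfield_scale q = (\<lambda>h v. fls_compose_power h q * v)"

lemma subfield_scale_const [simp]: "q > 0 \<Longrightarrow> subfield_scale q (fls_const c) v = fls_const c * v"
  by (simp add: subfield_scale_def)

lemma vector_space_subfield_scale: "q > 0 \<Longrightarrow> vector_space (subfield_scale q)"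
  by (rule vector_space.intro) (simp_all add: subfield_scale_def ring_distribs mult.assoc)

text \<open>
  The component \<open>h\<^sub>j\<close> in the decomposition \<open>v(t) = \<Sum>\<^sub>j h\<^sub>j(t\<^sup>q) t\<^sup>j\<close> over \<open>j < q\<close>.
\<close>

definition residue_part :: "nat \<Rightarrow> nat \<Rightarrow> 'a::zero fls \<Rightarrow> 'a fls" where
  "residue_part q j v = Abs_fls (\<lambda>k. v $$ (int q * k + int j))"

lemma residue_part_nth:
  assumes "j < q"
  shows "residue_part q j v $$ k = v $$ (int q * k + int j)"
  unfolding residue_part_def
proof (rule nth_Abs_fls_lower_bound[of "- \<bar>fls_subdegree v\<bar> - 1"], intro allI impI)
  fix k assume k: "k < - \<bar>fls_subdegree v\<bar> - 1"
  have "int q * k + int j < int q * (k + 1)" using assms by (simp add: algebra_simps)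
  also have "\<dots> \<le> 1 * (k + 1)"
    using assms k by (intro mult_right_mono_neg) auto
  also have "\<dots> < fls_subdegree v" using k by simp
  finally show "v $$ (int q * k + int j) = 0" by simp
qed

lemma residue_part_order:
  assumes "j < q" "order_ge (int q * M) v"
  shows "order_ge M (residue_part q j v)"
  unfolding order_ge_def
proof (intro allI impI)
  fix k assume "k < M"
  then have "int q * (k + 1) \<le> int q * M" by (intro mult_left_mono) auto
  then have "int q * k + int j < int q * M" using assms(1) by (simp add: algebra_simps)
  then show "residue_part q j v $$ k = 0"
    using assms by (simp add: residue_part_nth order_ge_def)
qed

lemma residue_part_decomposition:
  fixes v :: "'a::field fls"
  assumes "q > 0"
  shows "v = (\<Sum>j<q. subfield_scale q (residue_part q j v) (fls_X_intpow (int j)))"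
proof (rule fls_eqI)
  fix n
  have "(\<Sum>j<q. subfield_scale q (residue_part q j v) (fls_X_intpow (int j))) $$ n
    = (\<Sum>j<q. if j = nat (n mod int q) then v $$ n else 0)"
    unfolding fls_nth_sum
  proof (rule sum.cong)
    fix j assume "j \<in> {..<q}"
    then have j: "j < q" by simp
    have "int q dvd n - int j \<longleftrightarrow> j = nat (n mod int q)"
    proof -
      have "int q dvd n - int j \<longleftrightarrow> n mod int q = int j mod int q"
        by (rule mod_eq_dvd_iff[symmetric])
      also have "int j mod int q = int j" using j by simp
      finally show ?thesis using assms by auto
    qed
    moreover have "int q * ((n - int j) div int q) + int j = n" if "int q dvd n - int j"
      using that by simp
    ultimately show "subfield_scale q (residue_part q j v) (fls_X_intpow (int j)) $$ n
        = (if j = nat (n mod int q) then v $$ n else 0)"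
      using j assms
      by (simp add: subfield_scale_def fls_X_intpow_times_conv_shift fls_nth_compose_power residue_part_nth)
  qed simp
  also have "\<dots> = v $$ n"
    using assms by (auto simp: nat_less_iff)
  finally show "v $$ n = (\<Sum>j<q. subfield_scale q (residue_part q j v) (fls_X_intpow (int j))) $$ n" ..
qed

lemma span_X_intpow:
  fixes M :: int
  assumes "q > 0"
  shows "module.span (subfield_scale q) ((\<lambda>j. fls_X_intpow (int q * M + int j)) ` {..<q}) = (UNIV :: 'a::field fls set)"
proof -
  interpret vector_space "subfield_scale q :: 'a fls \<Rightarrow> 'a fls \<Rightarrow> 'a fls"
    by (rule vector_space_subfield_scale[OF assms])
  let ?B = "(\<lambda>j. fls_X_intpow (int q * M + int j)) ` {..<q} :: 'a fls set"
  have "v \<in> span ?B" for v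
  proof -
    let ?w = "fls_X_intpow (- (int q * M)) * v"
    have "v = fls_X_intpow (int q * M) * ?w"
      by (simp add: fls_shift_1_times)
    also have "\<dots> = fls_X_intpow (int q * M) * (\<Sum>j<q. subfield_scale q (residue_part q j ?w) (fls_X_intpow (int j)))"
      by (rule arg_cong[OF residue_part_decomposition[OF assms]])
    also have "\<dots> = (\<Sum>j<q. subfield_scale q (residue_part q j ?w) (fls_X_intpow (int q * M + int j)))"
      unfolding sum_distrib_left subfield_scale_def mult.left_commute[of "fls_X_intpow (int q * M)"]
        fls_X_intpow_times_fls_X_intpow ..
    also have "\<dots> \<in> span ?B"
      by (intro span_sum span_scale span_base) auto
    finally show ?thesis .
  qed
  then show ?thesis by blast
qed

lemma fin_dim_subfield_scale: "q > 0 \<Longrightarrow> fin_dim_space (subfield_scale q)"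
  unfolding fin_dim_space_def
  using vector_space_subfield_scale[of q] span_X_intpow[of q 0] by (meson finite_imageI finite_lessThan)

lemma linear_intro:
  assumes "vector_space s1" "vector_space s2"
    "\<And>x y. f (x + y) = f x + f y" "\<And>c x. f (s1 c x) = s2 c (f x)"
  shows "Vector_Spaces.linear s1 s2 f"
  using assms by (simp add: linear_iff_module_hom module_hom_def module_hom_axioms_def module_iff_vector_space)

lemma k_linear_intro:
  assumes "vector_space sc" "\<And>x y. L (x + y) = L x + L y" "\<And>c x. L (sc (fls_const c) x) = sc (fls_const c) (L x)"
  shows "k_linear sc L"
proof -
  interpret vector_space sc by fact
  have "vector_space (\<lambda>c. sc (fls_const c))"
    by (rule vector_space.intro)
      (simp_all add: scale_right_distrib scale_left_distrib flip: fls_plus_const)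
  then show ?thesis
    unfolding k_linear_def using assms by (intro linear_intro) auto
qed

section \<open>The adic topology\<close>

lemma order_ge_imp_fps: "order_ge 0 h \<Longrightarrow> fps_to_fls (fls_regpart h) = h"
  by (rule fls_eqI) (auto simp: order_ge_def)

text \<open>
  Convergence with respect to all lattices is convergence in the order of \<open>t\<close>. One direction uses the
  lattices with basis \<open>t\<^sup>q\<^sup>M\<^sup>+\<^sup>j\<close>, which lie deep in the filtration. For the other, expand
  \<open>1, t, \<dots>, t\<^sup>q\<^sup>-\<^sup>1\<close> in the spanning set of a given lattice: the finitely many coefficients have
  bounded poles, so all series of sufficiently high order lie in the lattice.
\<close>

lemma adic_limit_iff:
  fixes X :: "nat \<Rightarrow> 'a::field fls"
  assumes q: "q > 0"
  shows "adic_limit (subfield_scale q) X w \<longleftrightarrow> (\<forall>N. \<forall>\<^sub>F n in sequentially. order_ge N (X n - w))"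
proof
  assume lim: "adic_limit (subfield_scale q) X w"
  show "\<forall>N. \<forall>\<^sub>F n in sequentially. order_ge N (X n - w)"
  proof
    fix N :: int
    \<comment> \<open>The absolute value makes \<open>q M + j \<ge> N\<close> hold for negative \<open>N\<close> too.\<close>
    let ?B = "(\<lambda>j. fls_X_intpow (int q * \<bar>N\<bar> + int j)) ` {..<q} :: 'a fls set"
    let ?L = "{\<Sum>b\<in>?B. subfield_scale q (fps_to_fls (c b)) b | c. True}"
    have "lattice_in (subfield_scale q) ?L"
      unfolding lattice_in_def using span_X_intpow[OF q] by blast
    with lim have "\<forall>\<^sub>F n in sequentially. X n - w \<in> ?L"
      unfolding adic_limit_def by blast
    moreover have "order_ge N v" if v: "v \<in> ?L" for v
    proof -
      have "order_ge N (subfield_scale q (fps_to_fls p) b)" if b_in: "b \<in> ?B" for p b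
      proof -
        obtain j where b: "b = fls_X_intpow (int q * \<bar>N\<bar> + int j)" using b_in by blast
        have "order_ge 0 (fls_compose_power (fps_to_fls p) q)"
          using q by (simp add: fls_compose_power_fps_to_fls)
        moreover have "1 * \<bar>N\<bar> \<le> int q * \<bar>N\<bar>"
          using q by (intro mult_right_mono) auto
        then have "order_ge N b" unfolding b by simp
        ultimately show ?thesis
          using order_ge_mult[of 0 _ N b] by (simp add: subfield_scale_def)
      qed
      then show ?thesis using v by (auto intro!: order_ge_sum)
    qed
    ultimately show "\<forall>\<^sub>F n in sequentially. order_ge N (X n - w)"
      by (rule eventually_mono)
  qed
next
  assume lim: "\<forall>N. \<forall>\<^sub>F n in sequentially. order_ge N (X n - w)"
  interpret vector_space "subfield_scale q :: 'a fls \<Rightarrow> 'a fls \<Rightarrow> 'a fls"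
    by (rule vector_space_subfield_scale[OF q])
  show "adic_limit (subfield_scale q) X w"
    unfolding adic_limit_def
  proof (intro allI impI)
    fix L assume "lattice_in (subfield_scale q) (L :: 'a fls set)"
    then obtain B where B: "finite B" "span B = UNIV"
      and L: "L = {\<Sum>b\<in>B. subfield_scale q (fps_to_fls (c b)) b | c. True}"
      unfolding lattice_in_def by blast
    have "\<exists>c. fls_X_intpow (int j) = (\<Sum>b\<in>B. subfield_scale q (c b) b)" for j
    proof -
      have "(fls_X_intpow (int j) :: 'a fls) \<in> span B" by (simp add: B)
      then show ?thesis unfolding span_finite[OF B(1)] by auto
    qed
    then obtain c where c: "\<And>j. fls_X_intpow (int j) = (\<Sum>b\<in>B. subfield_scale q (c j b) b)"
      by metis
    define M where "M = (\<Sum>j<q. \<Sum>b\<in>B. \<bar>fls_subdegree (c j b)\<bar>)"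
    have M: "order_ge (- M) (c j b)" if "j < q" "b \<in> B" for j b
    proof -
      have "\<bar>fls_subdegree (c j b)\<bar> \<le> (\<Sum>b\<in>B. \<bar>fls_subdegree (c j b)\<bar>)"
        using that B(1) by (intro member_le_sum) auto
      also have "\<dots> \<le> M"
        unfolding M_def using that by (intro member_le_sum[of j "{..<q}" "\<lambda>j. \<Sum>b\<in>B. \<bar>fls_subdegree (c j b)\<bar>"] sum_nonneg) auto
      finally show ?thesis by (intro order_ge_mono[OF order_ge_subdegree]) simp
    qed
    have "v \<in> L" if v: "order_ge (int q * M) v" for v
    proof -
      define h where "h = (\<lambda>j. residue_part q j v)"
      define d where "d = (\<lambda>b. \<Sum>j<q. h j * c j b)"
      have "order_ge 0 (d b)" if "b \<in> B" for b
        unfolding d_def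
      proof (rule order_ge_sum)
        fix j assume "j \<in> {..<q}"
        then show "order_ge 0 (h j * c j b)"
          using order_ge_mult[of M "h j" "- M" "c j b"] M[of j b] residue_part_order[OF _ v] that
          by (simp add: h_def)
      qed
      then have d: "fps_to_fls (fls_regpart (d b)) = d b" if "b \<in> B" for b
        using that by (simp add: order_ge_imp_fps)
      have "v = (\<Sum>j<q. subfield_scale q (h j) (\<Sum>b\<in>B. subfield_scale q (c j b) b))"
        unfolding c[symmetric] h_def by (rule residue_part_decomposition[OF q])
      also have "\<dots> = (\<Sum>j<q. \<Sum>b\<in>B. subfield_scale q (h j * c j b) b)"
        by (simp only: scale_sum_right scale_scale)
      also have "\<dots> = (\<Sum>b\<in>B. subfield_scale q (d b) b)"
        unfolding d_def by (subst sum.swap) (simp only: scale_sum_left)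
      also have "\<dots> = (\<Sum>b\<in>B. subfield_scale q (fps_to_fls (fls_regpart (d b))) b)"
        by (rule sum.cong) (simp_all only: d)
      finally show ?thesis unfolding L by (auto intro!: exI[of _ "\<lambda>b. fls_regpart (d b)"])
    qed
    then show "\<forall>\<^sub>F n in sequentially. X n - w \<in> L"
      using lim by (blast intro: eventually_mono)
  qed
qed

lemma adic_limit_unique:
  fixes X :: "nat \<Rightarrow> 'a::field fls"
  assumes q: "q > 0" and "adic_limit (subfield_scale q) X w" "adic_limit (subfield_scale q) X w'"
  shows "w = w'"
proof -
  have "order_ge N (w - w')" for N
  proof -
    have "\<forall>\<^sub>F n in sequentially. order_ge N (X n - w)" "\<forall>\<^sub>F n in sequentially. order_ge N (X n - w')"
      using assms by (simp_all add: adic_limit_iff)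
    then have "\<forall>\<^sub>F n in sequentially. order_ge N (w - w')"
    proof eventually_elim
      case (elim n)
      from order_ge_diff[OF elim(2,1)] show ?case by simp
    qed
    then show ?thesis by simp
  qed
  then show ?thesis using order_ge_all_imp_0[of 0 "w - w'"] by simp
qed

section \<open>The objects \<open>E\<^sub>f\<close> and \<open>D\<^sub>g\<close>\<close>

lemma scal_E_obj: "scal (E_obj r f) = subfield_scale r"
  by (simp add: E_obj_def subfield_scale_def)

lemma scal_D_obj: "scal (D_obj s g) = subfield_scale s"
  by (simp add: D_obj_def subfield_scale_def)

lemma z_nabla_E_obj:
  assumes "r > 0"
  shows "z_nabla (E_obj r f) = euler_connection r f"
proof
  fix v
  show "z_nabla (E_obj r f) v = euler_connection r f v"
    using assms
    by (simp add: z_nabla_def E_obj_def puiseux_deriv_def euler_connection_def distrib_left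
        fls_shift_1_times fls_X_times_conv_shift fls_shifted_times_simps mult.assoc)
qed

lemma puiseux_deriv_mult:
  "puiseux_deriv q (v * w) = puiseux_deriv q v * w + v * puiseux_deriv q w"
  by (simp add: puiseux_deriv_def algebra_simps)

lemma puiseux_deriv_nth:
  "puiseux_deriv q v $$ n = of_int (n + int q) / of_nat q * v $$ (n + int q)"
  by (simp add: puiseux_deriv_def mult.assoc fls_shift_1_times)

lemma puiseux_deriv_compose_power:
  fixes h :: "'a::field_char_0 fls"
  assumes "q > 0"
  shows "puiseux_deriv q (fls_compose_power h q) = fls_compose_power (fls_deriv h) q"
proof (rule fls_eqI)
  fix n
  have "(n + int q) div int q = n div int q + 1" using assms by simp
  moreover have "(of_int (n + int q) :: 'a) / of_nat q = of_int (n div int q + 1)" if "int q dvd n"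
    using that assms by (auto simp: field_simps elim!: dvdE)
  ultimately show "puiseux_deriv q (fls_compose_power h q) $$ n = fls_compose_power (fls_deriv h) q $$ n"
    using assms unfolding puiseux_deriv_nth
    by (cases "int q dvd n") (simp_all add: fls_nth_compose_power del: times_divide_eq_left of_int_add)
qed

lemma connection_E_obj:
  assumes "r > 0"
  shows "connection (E_obj r f)"
proof -
  have oper: "oper (E_obj r f) v = puiseux_deriv r v + fls_X_intpow (- int r) * f * v" for v
    by (simp add: E_obj_def)
  have add: "oper (E_obj r f) (v + w) = oper (E_obj r f) v + oper (E_obj r f) w" for v w
    by (simp add: oper puiseux_deriv_def algebra_simps)
  have leibniz: "oper (E_obj r f) (subfield_scale r h v)
      = subfield_scale r h (oper (E_obj r f) v) + subfield_scale r (fls_deriv h) v" for h v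
    by (simp add: oper subfield_scale_def puiseux_deriv_mult puiseux_deriv_compose_power[OF assms] algebra_simps)
  have "k_linear (subfield_scale r) (oper (E_obj r f))"
  proof (rule k_linear_intro[OF vector_space_subfield_scale[OF assms] add])
    show "oper (E_obj r f) (subfield_scale r (fls_const c) v) = subfield_scale r (fls_const c) (oper (E_obj r f) v)" for c v
      unfolding leibniz by (simp add: subfield_scale_def)
  qed
  then show ?thesis
    unfolding connection_def scal_E_obj using leibniz fin_dim_subfield_scale[OF assms] by blast
qed

lemma diff_operator_D_obj:
  assumes "s > 0" "g \<noteq> 0"
  shows "diff_operator (D_obj s g)"
proof -
  have phi: "exact 0 (phi_ext s :: 'a fls \<Rightarrow> 'a fls)" by (rule exact_phi_ext[OF assms(1)])
  have oper: "oper (D_obj s g) v = g * phi_ext s v" for v by (simp add: D_obj_def)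
  have "exact (fls_subdegree g) (\<lambda>v. g * v)"
    using assms by (intro exact_mult order_ge_subdegree) simp
  from exact_comp[OF this phi] have D: "exact (fls_subdegree g + 0) (oper (D_obj s g))"
    by (simp add: oper[abs_def])
  have "k_linear (subfield_scale s) (oper (D_obj s g))"
    using filtered_add[OF exact_filtered[OF D]] filtered_scale[OF exact_filtered[OF D]] assms
    by (intro k_linear_intro vector_space_subfield_scale) simp_all
  moreover have "oper (D_obj s g) (subfield_scale s h v) = subfield_scale s (phi h) (oper (D_obj s g) v)" for h v
    unfolding oper subfield_scale_def phi_ext_mult[OF assms(1)] phi_ext_compose_power[OF assms(1)]
    by (simp add: mult_ac)
  ultimately show ?thesis
    unfolding diff_operator_def scal_D_obj
    using exact_bij[OF D] fin_dim_subfield_scale[OF assms(1)] by blast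
qed

lemma diff_iso_transport:
  assumes N: "diff_operator N" and G: "bij G" and add: "\<And>v w. G (v + w) = G v + G w"
    and sc: "\<And>h w. scal M h (G w) = G (scal N h w)" and op: "\<And>w. oper M (G w) = G (oper N w)"
  shows "diff_iso M N"
proof -
  interpret N: vector_space "scal N" using N by (simp add: diff_operator_def fin_dim_space_def)
  have surj: "\<exists>w. v = G w" for v using G by (metis bij_pointE)
  have vs: "vector_space (scal M)"
  proof (rule vector_space.intro)
    fix a b x y
    obtain x' y' where [simp]: "x = G x'" "y = G y'" using surj by blast
    show "scal M a (x + y) = scal M a x + scal M a y"
      by (simp add: sc N.scale_right_distrib flip: add)
    show "scal M (a + b) x = scal M a x + scal M b x"
      by (simp add: sc N.scale_left_distrib add)
    show "scal M a (scal M b x) = scal M (a * b) x"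
      by (simp add: sc)
    show "scal M 1 x = x" by (simp add: sc)
  qed
  have lin: "Vector_Spaces.linear (scal N) (scal M) G"
    by (rule linear_intro[OF N.vector_space_axioms vs add]) (simp add: sc)
  obtain B where B: "finite B" "module.span (scal N) B = UNIV"
    using N by (auto simp: diff_operator_def fin_dim_space_def)
  have "module.span (scal M) (G ` B) = UNIV"
    using module_hom.span_image[OF lin[unfolded linear_iff_module_hom], of B] B G by (simp add: bij_is_surj)
  then have fin: "fin_dim_space (scal M)"
    unfolding fin_dim_space_def using vs B(1) by blast
  have N_lin: "oper N (x + y) = oper N x + oper N y" "oper N (scal N (fls_const c) x) = scal N (fls_const c) (oper N x)" for x y c
    using N unfolding diff_operator_def k_linear_def Vector_Spaces.linear_iff by blast+
  have k: "k_linear (scal M) (oper M)"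
  proof (rule k_linear_intro[OF vs])
    fix x y c
    obtain x' y' where [simp]: "x = G x'" "y = G y'" using surj by blast
    show "oper M (x + y) = oper M x + oper M y"
      by (simp add: op N_lin flip: add)
    show "oper M (scal M (fls_const c) x) = scal M (fls_const c) (oper M x)"
      by (simp add: op sc N_lin)
  qed
  have inv: "inv G (G w) = w" for w using G by (simp add: bij_is_inj)
  have inv': "G (inv G v) = v" for v using G by (simp add: bij_is_surj surj_f_inv_f)
  have "oper M = G \<circ> oper N \<circ> inv G"
    by (rule ext) (simp add: inv' flip: op)
  then have bij: "bij (oper M)"
    using N G by (simp add: diff_operator_def bij_comp bij_imp_bij_inv)
  have semilin: "oper M (scal M h v) = scal M (phi h) (oper M v)" for h v
  proof -
    obtain w where [simp]: "v = G w" using surj by blast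
    show ?thesis using N by (simp add: op sc diff_operator_def)
  qed
  have M: "diff_operator M"
    unfolding diff_operator_def using fin k bij semilin by blast
  have "Vector_Spaces.linear (scal M) (scal N) (inv G)"
  proof (rule linear_intro[OF vs N.vector_space_axioms])
    fix x y c
    obtain x' y' where [simp]: "x = G x'" "y = G y'" using surj by blast
    show "inv G (x + y) = inv G x + inv G y" by (simp add: inv flip: add)
    show "inv G (scal M c x) = scal N c (inv G x)" by (simp add: inv sc)
  qed
  moreover have "inv G (oper M v) = oper N (inv G v)" for v
  proof -
    obtain w where [simp]: "v = G w" using surj by blast
    show ?thesis by (simp add: inv op)
  qed
  ultimately show ?thesis
    unfolding diff_iso_def using M N bij_imp_bij_inv[OF G] by blast
qed

section \<open>The transform computed in the model\<close>

text \<open>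
  Through \<open>G\<close> the operator \<open>\<theta>\<close> becomes multiplication by \<open>u\<^sup>s\<close>, so the partial sums of \<open>h(\<theta>)\<close> become
  multiplications by truncations of \<open>h(u\<^sup>s)\<close>, and they converge to multiplication by \<open>h(u\<^sup>s)\<close> because \<open>G\<close> is
  continuous. Thus \<open>G\<close> carries the \<open>\<k>((\<theta>))\<close>-structure and the operator of \<open>D\<^sub>g\<close> to those of the transform.
\<close>

lemma local_mellin_model:
  fixes f g :: "'a::field_char_0 fls"
  assumes s: "s > 0" and r: "r > 0" and g0: "g \<noteq> 0"
    and G: "exact 0 G"
    and G_nabla: "\<And>v. euler_connection r f (G v) = - G (fls_X_intpow (- int s) * v)"
    and G_z: "\<And>v. fls_X_intpow (int r) * G v = G (g * phi_ext s v)"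
  shows "mellin_defined (E_obj r f) \<and> diff_iso (local_mellin (E_obj r f)) (D_obj s g)"
proof -
  let ?E = "E_obj r f"
  note Gf = exact_filtered[OF G]
  have bijG: "bij G" by (rule exact_bij[OF G])
  have injG: "G v = G w \<longleftrightarrow> v = w" for v w using bijG by (simp add: bij_is_inj inj_eq)
  have surjG: "\<exists>w. v = G w" for v using bijG by (metis bij_pointE)
  have P: "z_nabla ?E (G v) = - G (fls_X_intpow (- int s) * v)" for v
    unfolding z_nabla_E_obj[OF r] by (rule G_nabla)
  have P': "z_nabla ?E (- G (fls_X_intpow (int s) * v)) = G v" for v
    using P[of "- (fls_X_intpow (int s) * v)"]
    by (simp add: filtered_uminus[OF Gf] fls_shift_1_times)
  have bijP: "bij (z_nabla ?E)"
  proof (rule bijI)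
    show "inj (z_nabla ?E)"
    proof (rule injI)
      fix x y assume *: "z_nabla ?E x = z_nabla ?E y"
      obtain x' y' where xy: "x = G x'" "y = G y'" using surjG by blast
      from * show "x = y" unfolding xy P by (simp add: injG fls_shift_eq0_iff)
    qed
    show "surj (z_nabla ?E)"
      unfolding surj_def using surjG P' by metis
  qed
  have th: "theta ?E (G v) = G (fls_X_intpow (int s) * v)" for v
  proof -
    have "inv (z_nabla ?E) (G v) = - G (fls_X_intpow (int s) * v)"
      by (rule inv_f_eq[OF bij_is_inj[OF bijP] P'])
    then show ?thesis by (simp add: theta_def)
  qed
  have inj_th: "inj (theta ?E)"
  proof (rule injI)
    fix x y assume *: "theta ?E x = theta ?E y"
    obtain x' y' where xy: "x = G x'" "y = G y'" using surjG by blast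
    from * show "x = y" unfolding xy th by (simp add: injG fls_shift_eq0_iff)
  qed
  have th_inv: "inv (theta ?E) (G v) = G (fls_X_intpow (- int s) * v)" for v
    by (rule inv_f_eq[OF inj_th]) (simp add: th fls_shift_1_times)
  have pow: "theta_pow ?E i (G v) = G (fls_X_intpow (int s * i) * v)" for i v
  proof -
    have 1: "(theta ?E ^^ n) (G v) = G (fls_X_intpow (int s * int n) * v)" for n
      by (induction n) (simp_all add: th fls_shift_1_times algebra_simps)
    have 2: "(inv (theta ?E) ^^ n) (G v) = G (fls_X_intpow (- (int s * int n)) * v)" for n
      by (induction n) (simp_all add: th_inv fls_shift_1_times algebra_simps)
    show ?thesis
      unfolding theta_pow_def by (simp add: 1 2)
  qed
  \<comment> \<open>The truncation of \<open>h(u\<^sup>s)\<close> that corresponds to the \<open>n\<close>-th partial sum.\<close>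
  define p where "p = (\<lambda>(h :: 'a fls) n. \<Sum>i\<in>{fls_subdegree h..int n}. fls_const (h $$ i) * fls_X_intpow (int s * i))"
  have partial: "theta_partial ?E h (G w) n = G (p h n * w)" for h w n
    unfolding theta_partial_def scal_E_obj p_def pow sum_distrib_right mult.assoc
    using r by (simp add: filtered_sum[OF Gf] filtered_scale[OF Gf])
  have p_nth: "p h n $$ k = (if int s dvd k \<and> k div int s \<le> int n then h $$ (k div int s) else 0)" for h n k
  proof -
    have "p h n $$ k = (\<Sum>i\<in>{fls_subdegree h..int n}. if i = k div int s then (if int s dvd k then h $$ i else 0) else 0)"
      unfolding p_def fls_nth_sum
      by (rule sum.cong) (use s in \<open>auto simp: fls_shift_1_times fls_X_intpow_times_conv_shift\<close>)
    then show ?thesis by (auto simp: not_le)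
  qed
  have lim: "adic_limit (scal ?E) (theta_partial ?E h (G w)) (G (subfield_scale s h w))" for h w
    unfolding scal_E_obj adic_limit_iff[OF r] partial
  proof
    fix N
    have "order_ge (int n - \<bar>fls_subdegree w\<bar>) (G (p h n * w) - G (subfield_scale s h w))" for n
    proof -
      have "order_ge (int n) (p h n - fls_compose_power h s)"
        unfolding order_ge_def
      proof (intro allI impI)
        fix k assume k: "k < int n"
        have "k div int s \<le> int n"
        proof (cases "k \<ge> 0")
          case True
          then have "k div int s \<le> k" using s zdiv_mono2[of k 1 "int s"] by simp
          then show ?thesis using k by simp
        next
          case False
          then have "k div int s < 0" using s by (simp add: pos_imp_zdiv_neg_iff)
          then show ?thesis by simp
        qed
        then show "(p h n - fls_compose_power h s) $$ k = 0"
          using s by (simp add: p_nth fls_nth_compose_power)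
      qed
      from order_ge_mult[OF this order_ge_subdegree[of w]]
      have "order_ge (int n - \<bar>fls_subdegree w\<bar>) ((p h n - fls_compose_power h s) * w)"
        by (rule order_ge_mono) simp
      from filtered_order[OF Gf this]
      show ?thesis
        by (simp add: subfield_scale_def left_diff_distrib filtered_diff[OF Gf])
    qed
    moreover have "\<forall>\<^sub>F n in sequentially. N \<le> int n - \<bar>fls_subdegree w\<bar>"
      using eventually_ge_at_top[of "nat (N + \<bar>fls_subdegree w\<bar>)"] by eventually_elim auto
    ultimately show "\<forall>\<^sub>F n in sequentially. order_ge N (G (p h n * w) - G (subfield_scale s h w))"
      by (auto elim!: eventually_mono intro: order_ge_mono)
  qed
  have uniq: "x = G (subfield_scale s h w)" if "adic_limit (scal ?E) (theta_partial ?E h (G w)) x" for x h w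
    using adic_limit_unique[OF r] that lim[of h w] unfolding scal_E_obj by blast
  have "\<exists>!x. adic_limit (scal ?E) (theta_partial ?E h v) x" for h v
    using surjG[of v] lim uniq by blast
  then have def: "mellin_defined ?E"
    unfolding mellin_defined_def using connection_E_obj[OF r] bijP by blast
  have "diff_iso (local_mellin ?E) (D_obj s g)"
  proof (rule diff_iso_transport[OF diff_operator_D_obj[OF s g0] bijG filtered_add[OF Gf]])
    show "scal (local_mellin ?E) h (G w) = G (scal (D_obj s g) h w)" for h w
      unfolding scal_D_obj local_mellin_def using lim uniq by (simp add: the_equality)
    show "oper (local_mellin ?E) (G w) = G (oper (D_obj s g) w)" for w
      using G_z[of w] r unfolding local_mellin_def scal_E_obj by (simp add: D_obj_def subfield_scale_def)
  qed
  with def show ?thesis by blast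
qed

section \<open>Irreducibility of the class of \<open>g\<close>\<close>

lemma galois_nth: "\<eta> \<noteq> 0 \<Longrightarrow> galois \<eta> f $$ n = f $$ n * \<eta> powi n"
  by (simp add: galois_def fls_nth_fls_compose_fps_linear)

lemma galois_subst: "\<eta> \<noteq> 0 \<Longrightarrow> fps_const \<eta> * fps_X \<noteq> 0" "(fps_const \<eta> * fps_X) $ 0 = 0"
  for \<eta> :: "'a::field"
  by (auto intro!: fps_order1_nonzero)

lemma galois_mult: "\<eta> \<noteq> 0 \<Longrightarrow> galois \<eta> (f * g) = galois \<eta> f * galois \<eta> g"
  by (simp add: galois_def fls_compose_fps_mult)

lemma galois_order: "\<eta> \<noteq> 0 \<Longrightarrow> order_ge N f \<Longrightarrow> order_ge N (galois \<eta> f)"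
  by (simp add: order_ge_def galois_nth)

lemma root_of_unity_nonzero: "\<eta> ^ s = 1 \<Longrightarrow> s > 0 \<Longrightarrow> \<eta> \<noteq> (0::'a::field)"
  by (auto simp: power_0_left)

lemma prime_order_root_dvd:
  fixes \<zeta> :: "'a::field"
  assumes "prime ell" "\<zeta> ^ ell = 1" "\<zeta> \<noteq> 1" "\<zeta> powi k = 1"
  shows "int ell dvd k"
proof (rule ccontr)
  assume "\<not> int ell dvd k"
  then have "coprime (int ell) k"
    using assms(1) by (intro prime_imp_coprime) auto
  then obtain x y where xy: "int ell * x + k * y = 1"
    using bezout_int[of "int ell" k] by (metis coprime_imp_gcd_eq_1 mult.commute)
  have nz: "\<zeta> \<noteq> 0" using root_of_unity_nonzero[OF assms(2)] assms(1) prime_gt_0_nat by blast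
  have "\<zeta> = \<zeta> powi (int ell * x + k * y)" by (simp add: xy)
  also have "\<dots> = (\<zeta> powi int ell) powi x * (\<zeta> powi k) powi y"
    by (simp only: power_int_add[OF disjI1[OF nz]] power_int_mult)
  also have "\<dots> = 1" using assms by simp
  finally show False using assms(3) by simp
qed

lemma prime_order_root_exists:
  assumes "prime ell"
  obtains \<zeta> :: "'a::{alg_closed_field, field_char_0}" where "\<zeta> ^ ell = 1" "\<zeta> \<noteq> 1"
proof -
  define p where "p = (\<Sum>i<ell. monom (1::'a) i)"
  have l: "ell \<ge> 2" using prime_ge_2_nat[OF assms] .
  have "coeff p (ell - 1) = (\<Sum>i<ell. if i = ell - 1 then 1 else 0)"
    unfolding p_def coeff_sum by (rule sum.cong) auto
  then have "coeff p (ell - 1) \<noteq> 0" using l by simp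
  then have "ell - 1 \<le> degree p" by (rule le_degree)
  then have "degree p > 0" using l by simp
  then obtain x where "poly p x = 0" using alg_closed_imp_poly_has_root by blast
  then have x: "(\<Sum>i<ell. x ^ i) = 0" by (simp add: p_def poly_sum poly_monom)
  show thesis
  proof
    show "x ^ ell = 1" using power_diff_1_eq[of x ell] x by simp
    show "x \<noteq> 1" using x l by auto
  qed
qed

text \<open>
  A series that lies in a smaller Puiseux field is supported on the multiples of a divisor of \<open>q\<close>
  greater than \<open>1\<close>; a prime factor of that divisor suffices below.
\<close>

lemma in_puiseux_support:
  assumes "in_puiseux q p f" "0 < p" "p < q"
  obtains ell where "prime ell" "ell dvd q" "\<And>k. f $$ k \<noteq> 0 \<Longrightarrow> int ell dvd k"
proof -
  obtain h where h: "fls_compose_power f p = fls_compose_power h q"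
    using assms(1) by (auto simp: in_puiseux_def)
  define d where "d = gcd q p"
  have d: "d dvd q" "d dvd p" "d > 0" using assms by (auto simp: d_def)
  have "d \<le> p" using d assms dvd_imp_le by blast
  then have "d < q" using assms by simp
  then have "q div d \<noteq> 1" using d by auto
  then obtain ell where l: "prime ell" "ell dvd q div d" using prime_factor_nat by blast
  show thesis
  proof
    show "prime ell" by fact
    show "ell dvd q" using l(2) d(1) by (metis dvd_div_mult_self dvd_mult2)
    fix k assume k: "f $$ k \<noteq> 0"
    have "fls_compose_power f p $$ (int p * k) \<noteq> 0"
      using k assms by (simp add: fls_nth_compose_power)
    then have "int q dvd int p * k"
      unfolding h using assms by (auto simp: fls_nth_compose_power split: if_splits)
    then have "int (q div d) * int d dvd (int (p div d) * k) * int d"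
      using d by (metis dvd_div_mult_self mult.assoc mult.commute of_nat_mult)
    then have "int (q div d) dvd int (p div d) * k"
      using d(3) by simp
    moreover have "coprime (q div d) (p div d)"
      unfolding d_def using assms by (intro div_gcd_coprime) auto
    then have "coprime (int (q div d)) (int (p div d))" by simp
    ultimately have "int (q div d) dvd k" by (simp add: coprime_dvd_mult_right_iff)
    then show "int ell dvd k" using l(2) by (meson dvd_trans int_dvd_int_iff)
  qed
qed

lemma in_puiseux_supportI:
  assumes "ell dvd q" "q > 0" "\<And>k. f $$ k \<noteq> 0 \<Longrightarrow> int ell dvd k"
  shows "in_puiseux q (q div ell) f"
proof -
  define e where "e = q div ell"
  have q: "q = e * ell" "e > 0" "ell > 0" using assms by (auto simp: e_def)
  have "fls_compose_power f e = fls_compose_power (residue_part ell 0 f) q"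
  proof (rule fls_eqI)
    fix n
    show "fls_compose_power f e $$ n = fls_compose_power (residue_part ell 0 f) q $$ n"
    proof (cases "int e dvd n")
      case True
      then obtain m where n: "n = int e * m" by (elim dvdE)
      have "int q dvd n \<longleftrightarrow> int ell dvd m" using q by (simp add: n)
      moreover have "n div int q = m div int ell" using q by (simp add: n)
      moreover have "f $$ m = 0" if "\<not> int ell dvd m" using assms(3) that by blast
      ultimately show ?thesis using q by (simp add: fls_nth_compose_power residue_part_nth n)
    next
      case False
      then have "\<not> int q dvd n" using q by (metis dvd_mult_left of_nat_mult)
      then show ?thesis using False q assms(2) by (simp add: fls_nth_compose_power)
    qed
  qed
  then show ?thesis unfolding in_puiseux_def e_def by blast
qed

lemma order_ge_cancel:
  fixes x y :: "'a::field fls"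
  assumes "order_ge N y" "y $$ N \<noteq> 0" "order_ge (M + N) (x * y)"
  shows "order_ge M x"
  using exact_order_iff[OF exact_mult[OF assms(1,2)], of M x] assms(3) by (simp add: mult.commute)

lemma power_int_order:
  fixes A :: "'a::field fps"
  assumes "A $ 0 = 0" "A $ 1 \<noteq> 0"
  shows "order_ge n (fps_to_fls A powi n)"
  using subdegree_order1[OF assms] by (simp add: order_ge_iff_subdegree fls_subdegree_fls_to_fps)

text \<open>
  Substituting two series with relative difference of order \<open>m\<close> gives results with relative difference
  of order \<open>m\<close>. By continuity only powers \<open>A\<^sup>n - B\<^sup>n\<close> have to be estimated, for positive and
  negative \<open>n\<close>.
\<close>

lemma compose_fps_diff_filtered:
  fixes A B :: "'a::field fps"
  assumes A: "A $ 0 = 0" "A $ 1 \<noteq> 0" and B: "B $ 0 = 0" "B $ 1 \<noteq> 0"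
    and AB: "order_ge (1 + m) (fps_to_fls A - fps_to_fls B)"
  shows "filtered m (\<lambda>v. fls_compose_fps v A - fls_compose_fps v B)"
proof (rule filtered_raise)
  show "filtered 0 (\<lambda>v. fls_compose_fps v A - fls_compose_fps v B)"
    by (intro filtered_fun_diff exact_filtered exact_compose_fps A B)
  fix n
  let ?A = "fps_to_fls A" and ?B = "fps_to_fls B"
  have nz: "?A \<noteq> 0" "?B \<noteq> 0" using A B fps_order1_nonzero by auto
  have "order_ge (n + m) (?A powi n - ?B powi n)"
  proof (induction n rule: int_induct[where k = 0])
    case base
    show ?case by simp
  next
    case (step1 i)
    have eq: "?A powi (i + 1) - ?B powi (i + 1) = ?A powi 1 * (?A powi i - ?B powi i) + (?A - ?B) * ?B powi i"
      using nz by (simp add: power_int_add algebra_simps)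
    have "1 + (i + m) = i + 1 + m" "1 + m + i = i + 1 + m" by simp_all
    then have "order_ge (i + 1 + m) (?A powi 1 * (?A powi i - ?B powi i))"
      "order_ge (i + 1 + m) ((?A - ?B) * ?B powi i)"
      using order_ge_mult[OF power_int_order[OF A, of 1] step1(2)] order_ge_mult[OF AB power_int_order[OF B, of i]]
      by (simp_all only:)
    then show ?case unfolding eq by (rule order_ge_add)
  next
    case (step2 i)
    have inv: "?A powi (-1) - ?B powi (-1) = (?B - ?A) * (?A powi (-1) * ?B powi (-1))"
      using nz by (simp add: power_int_minus field_simps)
    have "order_ge (1 + m) (?B - ?A)"
      using order_ge_uminus[OF AB] by simp
    from order_ge_mult[OF this order_ge_mult[OF power_int_order[OF A, of "-1"] power_int_order[OF B, of "-1"]]]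
    have "order_ge (m - 1) (?A powi (-1) - ?B powi (-1))"
      unfolding inv by simp
    from order_ge_mult[OF this power_int_order[OF B, of i]]
    have 1: "order_ge (i - 1 + m) ((?A powi (-1) - ?B powi (-1)) * ?B powi i)"
      by (simp add: algebra_simps)
    from order_ge_mult[OF power_int_order[OF A, of "-1"] step2(2)]
    have 2: "order_ge (i - 1 + m) (?A powi (-1) * (?A powi i - ?B powi i))"
      by (simp add: algebra_simps)
    have "?A powi (i - 1) - ?B powi (i - 1)
        = ?A powi (-1) * (?A powi i - ?B powi i) + (?A powi (-1) - ?B powi (-1)) * ?B powi i"
      using nz by (simp add: power_int_diff power_int_minus field_simps)
    then show ?case using order_ge_add[OF 2 1] by simp
  qed
  then show "order_ge (n + m) (fls_compose_fps (fls_X_intpow n) A - fls_compose_fps (fls_X_intpow n) B)"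
    using A B by (simp add: fls_compose_fps_X_intpow fps_order1_nonzero)
qed

text \<open>
  Passing from \<open>g\<close> to an equivalent \<open>g'\<close> does not affect invariance under \<open>\<zeta>\<close> up to relative order
  \<open>s\<close>: the factor in the subgroup has no terms of order strictly between \<open>0\<close> and \<open>s\<close>, and its term
  of order \<open>s\<close> is fixed by \<open>\<zeta>\<close>.
\<close>

lemma S_rel_subfield_root:
  fixes g g' :: "'a::field_char_0 fls"
  assumes s: "s > 0" and rel: "(g, g') \<in> S_rel s" and g: "order_ge N g"
    and \<zeta>: "\<zeta> ^ s = 1" and inv: "galois \<zeta> g' = g'"
  shows "order_ge (N + int s + 1) (galois \<zeta> g - g)"
proof -
  obtain \<eta> where \<eta>: "\<eta> ^ s = 1" and g0: "g \<noteq> 0" and quot: "g' / galois \<eta> g \<in> S_sub s"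
    using rel by (auto simp: S_rel_def)
  have nz: "\<eta> \<noteq> 0" "\<zeta> \<noteq> 0" using root_of_unity_nonzero \<eta> \<zeta> s by blast+
  define u where "u = g' / galois \<eta> g"
  have "galois \<eta> g \<noteq> 0" using g0 nz by (simp add: galois_def fls_compose_fps_eq_0_iff)
  then have g': "g' = galois \<eta> g * u" by (simp add: u_def)
  obtain n p where u: "u = 1 + fls_const (of_int n / of_nat s) * fls_X ^ s + fls_X ^ (s + 1) * fps_to_fls p"
    using quot unfolding u_def S_sub_def by blast
  have X: "fls_X ^ k = fls_X_intpow (int k)" for k by (simp add: fls_X_power_conv_shift_1)
  have u_nth: "u $$ k = (if k = 0 then 1 else 0) + (if k = int s then of_int n / of_nat s else 0)" if "k \<le> int s" for k
    using that unfolding u X by (simp add: fls_shift_1_times fls_X_intpow_times_conv_shift)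
  have u0: "order_ge 0 u" "u $$ 0 \<noteq> 0"
    using u_nth s by (auto simp: order_ge_def)
  have "order_ge (int s + 1) (u - galois \<zeta> u)"
    unfolding order_ge_def using u_nth \<zeta> by (auto simp: galois_nth[OF nz(2)])
  moreover have "order_ge N (galois \<zeta> (galois \<eta> g))"
    by (intro galois_order nz g)
  ultimately have "order_ge (N + (int s + 1)) (galois \<zeta> (galois \<eta> g) * (u - galois \<zeta> u))"
    by (rule order_ge_mult[rotated])
  moreover have "(galois \<zeta> (galois \<eta> g) - galois \<eta> g) * u = galois \<zeta> (galois \<eta> g) * (u - galois \<zeta> u)"
    using inv unfolding g' galois_mult[OF nz(2)] by (simp add: algebra_simps)
  ultimately have "order_ge (N + (int s + 1) + 0) ((galois \<zeta> (galois \<eta> g) - galois \<eta> g) * u)"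
    by simp
  then have ord: "order_ge (N + (int s + 1)) (galois \<zeta> (galois \<eta> g) - galois \<eta> g)"
    by (rule order_ge_cancel[OF u0])
  show ?thesis
    unfolding order_ge_def
  proof (intro allI impI)
    fix k assume "k < N + int s + 1"
    then have "(galois \<zeta> (galois \<eta> g) - galois \<eta> g) $$ k = 0"
      using ord by (simp add: order_ge_def)
    then have "(galois \<zeta> g - g) $$ k * \<eta> powi k = 0"
      by (simp add: galois_nth nz algebra_simps)
    then show "(galois \<zeta> g - g) $$ k = 0" using nz by simp
  qed
qed

text \<open>
  The terms of positive order may be dropped without changing the class of \<open>f\<close>.
\<close>

lemma R_circ_not_invariant:
  fixes f :: "'a::field_char_0 fls"
  assumes r: "r > 0" and f: "R_rel r `` {f} \<in> R_circ r"
    and l: "prime ell" "ell dvd r" and supp: "\<And>k. k \<le> 0 \<Longrightarrow> f $$ k \<noteq> 0 \<Longrightarrow> int ell dvd k"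
  shows False
proof -
  define q where "q = Abs_fps (\<lambda>i. f $$ (int i + 1))"
  define f' where "f' = f - fls_X * fps_to_fls q"
  have f': "f' $$ k = (if k \<le> 0 then f $$ k else 0)" for k
    by (simp add: f'_def q_def fls_X_times_conv_shift)
  have g1: "galois 1 f = f"
    by (rule fls_eqI) (simp add: galois_nth)
  have "f' - galois 1 f = fls_X * fps_to_fls (- q) + fls_const (of_int 0 / of_nat r)"
    by (simp add: g1 f'_def)
  then have "f' - galois 1 f \<in> R_sub r"
    unfolding R_sub_def by blast
  then have "(f, f') \<in> R_rel r"
    unfolding R_rel_def by (auto intro!: exI[of _ 1])
  moreover have "in_puiseux r (r div ell) f'"
    using supp f' by (intro in_puiseux_supportI[OF l(2) r]) (metis dvd_0_right)
  moreover have "0 < r div ell" "r div ell < r"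
    using r l prime_gt_1_nat[OF l(1)] by (auto simp: div_greater_zero_iff dvd_imp_le)
  ultimately show False using f unfolding R_circ_def by blast
qed

text \<open>
  If \<open>g\<close> were equivalent to an element of a smaller field, then for some prime \<open>ell\<close> dividing \<open>s\<close> and a
  primitive root of unity \<open>\<zeta>\<close> of that order, \<open>g\<close> would be invariant under \<open>u \<mapsto> \<zeta> u\<close> up to relative
  order \<open>s\<close>. The leading term forces \<open>ell\<close> to divide \<open>r\<close> as well, so \<open>T\<^sup>r\<close> is invariant to the same
  precision, which means that \<open>T(\<zeta> u)\<close> and \<open>\<zeta> T(u)\<close> agree up to relative order \<open>s\<close>. As \<open>f\<close> has a pole
  of order \<open>s\<close>, inserting this into \<open>f(T) = - u\<^sup>-\<^sup>s\<close> shows \<open>f(\<zeta> t) - f(t)\<close> to have positive order.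
  Then the class of \<open>f\<close> is represented in a smaller field, against the assumption.
\<close>

lemma S_circ_of_system:
  fixes f g :: "'a::{alg_closed_field, field_char_0} fls"
  assumes s: "s > 0" and r: "r > 0" and T0: "T $ 0 = 0" and T1: "T $ 1 = b" "b \<noteq> 0"
    and g: "g = fps_to_fls (T ^ r) - fls_const c * fls_X ^ (s + r)"
    and f: "fls_compose_fps f T = - fls_X_intpow (- int s)" "order_ge (- int s) f"
    and R: "R_rel r `` {f} \<in> R_circ r"
  shows "g \<noteq> 0" "S_rel s `` {g} \<in> S_circ s"
proof -
  define Z where "Z = fps_to_fls (T ^ r)"
  have X: "fls_X ^ (s + r) = fls_X_intpow (int s + int r)" by (simp add: fls_X_power_conv_shift_1)
  have Z_ord: "order_ge (int r) Z"
    unfolding Z_def order_ge_def using startsby_zero_power_prefix[OF T0] by auto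
  have Z_lead: "Z $$ int r = b ^ r"
    unfolding Z_def using startsby_zero_power_nth_same[OF T0] T1 by simp
  have g_lead: "g $$ int r = b ^ r"
    unfolding g Z_def[symmetric] X using Z_lead s by (simp add: fls_X_intpow_times_conv_shift)
  have g_ord: "order_ge (int r) g"
    unfolding g Z_def[symmetric] X by (intro order_ge_diff Z_ord order_ge_const_mult) simp
  show g0: "g \<noteq> 0" using g_lead T1 by (auto intro: fls_nonzeroI)
  have "\<not> in_puiseux s p g'" if p: "0 < p" "p < s" and g': "(g, g') \<in> S_rel s" for p g'
  proof
    assume "in_puiseux s p g'"
    then obtain ell where l: "prime ell" "ell dvd s" and supp: "\<And>k. g' $$ k \<noteq> 0 \<Longrightarrow> int ell dvd k"
      using in_puiseux_support p by blast
    obtain \<zeta> :: 'a where \<zeta>: "\<zeta> ^ ell = 1" "\<zeta> \<noteq> 1" by (rule prime_order_root_exists[OF l(1)])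
    have \<zeta>0: "\<zeta> \<noteq> 0" using root_of_unity_nonzero[OF \<zeta>(1)] prime_gt_0_nat[OF l(1)] by blast
    have \<zeta>_dvd: "\<zeta> powi k = 1" if "int ell dvd k" for k
      using that \<zeta>(1) by (auto elim!: dvdE simp: power_int_mult)
    have \<zeta>s: "\<zeta> ^ s = 1" using \<zeta>_dvd[of "int s"] l(2) by simp
    have "galois \<zeta> g' = g'"
      by (rule fls_eqI) (metis \<zeta>_dvd supp galois_nth[OF \<zeta>0] mult_1_right mult_zero_left)
    from S_rel_subfield_root[OF s g' g_ord \<zeta>s this]
    have inv: "order_ge (int r + int s + 1) (galois \<zeta> g - g)" .
    have "(galois \<zeta> g - g) $$ int r = 0" using inv s by (simp add: order_ge_def)
    then have \<zeta>r: "\<zeta> ^ r = 1" using T1 by (simp add: galois_nth[OF \<zeta>0] g_lead)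
    then have lr: "ell dvd r"
      using prime_order_root_dvd[OF l(1) \<zeta>, of "int r"] by simp
    define T' where "T' = fps_compose T (fps_const \<zeta> * fps_X)"
    define \<tau> where "\<tau> = fps_to_fls T"
    define \<tau>' where "\<tau>' = fps_to_fls T'"
    note sub = galois_subst(1)[OF \<zeta>0] galois_subst(2)[of \<zeta>]
    have \<tau>': "\<tau>' = galois \<zeta> \<tau>" unfolding \<tau>'_def \<tau>_def T'_def galois_def using sub by simp
    have T'_nth: "T' $ 0 = 0" "T' $ 1 = \<zeta> * b"
      by (simp_all add: T'_def fps_compose_linear T0 T1[simplified])
    have T_nz: "T \<noteq> 0" using T1 by (intro fps_order1_nonzero) simp
    define S where "S = fps_const \<zeta> * T"
    have S_nth: "S $ 0 = 0" "S $ 1 = \<zeta> * b" using T0 T1 by (simp_all add: S_def)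
    have lead_nz: "\<zeta> * b \<noteq> 0" using \<zeta>0 T1 by simp
    have "galois \<zeta> Z - Z = (galois \<zeta> g - g)"
    proof -
      have \<zeta>sr: "\<zeta> powi (int s + int r) = 1" using \<zeta>_dvd l(2) lr by simp
      have "galois \<zeta> (fls_const c * fls_X ^ (s + r)) = fls_const c * fls_X ^ (s + r)"
      proof (intro fls_eqI)
        fix k
        show "galois \<zeta> (fls_const c * fls_X ^ (s + r)) $$ k = (fls_const c * fls_X ^ (s + r)) $$ k"
          unfolding X galois_nth[OF \<zeta>0] using \<zeta>sr
          by (cases "k = int s + int r") (auto simp: fls_X_intpow_times_conv_shift)
      qed
      moreover have "galois \<zeta> (Z - g) = galois \<zeta> Z - galois \<zeta> g"
        unfolding galois_def using sub by (rule fls_compose_fps_diff)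
      moreover have "Z - g = fls_const c * fls_X ^ (s + r)" by (simp add: g Z_def)
      ultimately have "galois \<zeta> Z - galois \<zeta> g = Z - g" by simp
      then show ?thesis by (simp add: algebra_simps)
    qed
    moreover have "galois \<zeta> Z = \<tau>' ^ r"
      unfolding Z_def fps_to_fls_power \<tau>' \<tau>_def galois_def using sub by (rule fls_compose_fps_power)
    moreover have "Z = fps_to_fls S ^ r"
      using \<zeta>r by (simp add: Z_def S_def fps_to_fls_power[symmetric] power_mult_distrib fps_const_power)
    ultimately have diff: "order_ge (int r + int s + 1) (\<tau>' ^ r - fps_to_fls S ^ r)"
      using inv by simp
    \<comment> \<open>Factor the difference of the \<open>r\<close>-th powers; the cofactor \<open>Q\<close> has order exactly \<open>r - 1\<close>.\<close>
    define Q where "Q = (\<Sum>i<r. fps_to_fls S ^ (r - Suc i) * \<tau>' ^ i)"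
    have term_ord: "order_ge (int (r - 1)) (fps_to_fls S ^ (r - Suc i) * \<tau>' ^ i)"
      and term_lead: "(fps_to_fls S ^ (r - Suc i) * \<tau>' ^ i) $$ int (r - 1) = (\<zeta> * b) ^ (r - 1)" if "i < r" for i
    proof -
      have S_ord: "order_ge (int k) (fps_to_fls S ^ k)" and S_lead: "(fps_to_fls S ^ k) $$ int k = (\<zeta> * b) ^ k" for k
        using startsby_zero_power_prefix[OF S_nth(1)] startsby_zero_power_nth_same[OF S_nth(1)] S_nth(2)
        by (auto simp: order_ge_def simp flip: fps_to_fls_power)
      have T_ord: "order_ge (int k) (\<tau>' ^ k)" and T_lead: "(\<tau>' ^ k) $$ int k = (\<zeta> * b) ^ k" for k
        using startsby_zero_power_prefix[OF T'_nth(1)] startsby_zero_power_nth_same[OF T'_nth(1)] T'_nth(2)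
        by (auto simp: order_ge_def \<tau>'_def simp flip: fps_to_fls_power)
      have idx: "int (r - Suc i) + int i = int (r - 1)" "r - Suc i + i = r - 1" using that by auto
      show "order_ge (int (r - 1)) (fps_to_fls S ^ (r - Suc i) * \<tau>' ^ i)"
        using order_ge_mult[OF S_ord T_ord, of "r - Suc i" i] unfolding idx .
      show "(fps_to_fls S ^ (r - Suc i) * \<tau>' ^ i) $$ int (r - 1) = (\<zeta> * b) ^ (r - 1)"
        using fls_times_nth_leading[OF S_ord T_ord, of "r - Suc i" i]
        unfolding idx S_lead T_lead power_add[symmetric] .
    qed
    have Q: "order_ge (int (r - 1)) Q" unfolding Q_def by (intro order_ge_sum term_ord) simp
    have "Q $$ int (r - 1) = of_nat r * (\<zeta> * b) ^ (r - 1)"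
      unfolding Q_def fls_nth_sum using term_lead by simp
    then have Q_lead: "Q $$ int (r - 1) \<noteq> 0" using lead_nz r by simp
    have idx: "int r + int s + 1 = 1 + (int s + 1) + int (r - 1)" using r by (simp add: of_nat_diff)
    have "order_ge (1 + (int s + 1) + int (r - 1)) ((\<tau>' - fps_to_fls S) * Q)"
      using diff unfolding power_diff_sumr2 Q_def[symmetric] idx .
    then have "order_ge (1 + (int s + 1)) (\<tau>' - fps_to_fls S)"
      by (rule order_ge_cancel[OF Q Q_lead])
    then have "filtered (int s + 1) (\<lambda>v. fls_compose_fps v T' - fls_compose_fps v S)"
      unfolding \<tau>'_def using T'_nth S_nth lead_nz by (intro compose_fps_diff_filtered) auto
    from filtered_order[OF this f(2)]
    have ord1: "order_ge 1 (fls_compose_fps f T' - fls_compose_fps f S)" by simp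
    have "fls_compose_fps f T' = galois \<zeta> (fls_compose_fps f T)"
      unfolding T'_def galois_def using fls_compose_fps_assoc[OF T_nz T0 sub] by simp
    also have "\<dots> = fls_compose_fps f T"
    proof (rule fls_eqI)
      fix k
      have "\<zeta> powi (- int s) = 1" using \<zeta>_dvd l(2) by simp
      then show "galois \<zeta> (fls_compose_fps f T) $$ k = fls_compose_fps f T $$ k"
        unfolding f(1) galois_nth[OF \<zeta>0] by (cases "k = - int s") auto
    qed
    finally have fT': "fls_compose_fps f T' = fls_compose_fps f T" .
    have "S = (fps_const \<zeta> * fps_X) oo T"
      using T0 by (simp add: S_def fps_compose_mult_distrib)
    then have fS: "fls_compose_fps f S = fls_compose_fps (galois \<zeta> f) T"
      unfolding galois_def using fls_compose_fps_assoc[OF sub T_nz T0] by simp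
    have "order_ge (1 + 0) (fls_compose_fps (f - galois \<zeta> f) T)"
      using ord1 unfolding fT' fS fls_compose_fps_diff[OF T_nz T0] by simp
    then have "order_ge 1 (f - galois \<zeta> f)"
      using exact_order_iff[OF exact_compose_fps[OF T0]] T1 by metis
    then have "(f - galois \<zeta> f) $$ k = 0" if "k \<le> 0" for k
      using that by (simp add: order_ge_def)
    then have "\<zeta> powi k = 1" if "k \<le> 0" "f $$ k \<noteq> 0" for k
      using that by (fastforce simp: galois_nth[OF \<zeta>0])
    then have "int ell dvd k" if "k \<le> 0" "f $$ k \<noteq> 0" for k
      using prime_order_root_dvd[OF l(1) \<zeta>] that by blast
    then show False by (rule R_circ_not_invariant[OF r R l(1) lr])
  qed
  moreover have "S_rel s `` {g} \<in> S s"
    unfolding S_def using g0 by (intro quotientI) simp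
  ultimately show "S_rel s `` {g} \<in> S_circ s"
    unfolding S_circ_def by blast
qed

section \<open>Solving the system\<close>

text \<open>
  With \<open>f = t\<^sup>-\<^sup>s p(t)\<close> the equation says that \<open>u\<^sup>s = t\<^sup>s (- 1/p(t))\<close>; extract an \<open>s\<close>-th root \<open>u = Y(t)\<close>
  and invert it.
\<close>

lemma system_solvable:
  fixes f :: "'a::{alg_closed_field, field_char_0} fls"
  assumes s: "s > 0" and f: "order_ge (- int s) f" "f $$ (- int s) = a" and a: "a \<noteq> 0"
  obtains T where "T $ 0 = 0" "(T $ 1) ^ s = - a" "fls_compose_fps f T = - fls_X_intpow (- int s)"
proof -
  define p where "p = Abs_fps (\<lambda>i. f $$ (int i - int s))"
  have p0: "p $ 0 = a" by (simp add: p_def f)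
  have fp: "f = fls_shift (int s) (fps_to_fls p)"
    using f(1) by (intro fls_eqI) (simp add: p_def order_ge_def)
  obtain c where c: "c ^ s = - inverse a" using nth_root_exists[OF s] by blast
  \<comment> \<open>\<open>fps_radical\<close> consults its root function only at the constant coefficient.\<close>
  define root where "root = (\<lambda>(k::nat) (x::'a). c)"
  define q where "q = inverse (- p)"
  have q0: "q $ 0 = - inverse a" by (simp add: q_def p0)
  define R where "R = fps_radical root s q"
  obtain k where k: "s = Suc k" using s gr0_implies_Suc by blast
  have R: "R ^ s = q"
    using power_radical[of q root k] q0 c a by (simp add: R_def k root_def)
  define Y where "Y = fps_X * R"
  have R0: "R $ 0 = c" using s by (simp add: R_def root_def)
  have c0: "c \<noteq> 0" using c a s by (auto simp: power_0_left)
  have Y: "Y $ 0 = 0" "Y $ 1 \<noteq> 0" using R0 c0 by (simp_all add: Y_def)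
  define T where "T = fps_inv Y"
  have YT: "Y oo T = fps_X" unfolding T_def by (rule fps_inv_right[OF Y])
  have T0: "T $ 0 = 0" by (simp add: T_def fps_inv_def)
  have qp: "q * (- p) = 1" unfolding q_def using p0 a by (intro inverse_mult_eq_1) simp
  have "fps_X ^ s = Y ^ s * (- p)"
    unfolding Y_def power_mult_distrib R mult.assoc qp by simp
  then have "(fps_X ^ s) oo T = (Y ^ s * (- p)) oo T" by simp
  then have "T ^ s = (Y oo T) ^ s * (- (p oo T))"
    using T0 by (simp add: fps_compose_mult_distrib fps_compose_uminus flip: fps_compose_power)
  then have Ts: "T ^ s = - (fps_X ^ s * (p oo T))" unfolding YT by simp
  have T1: "(T $ 1) ^ s = - a"
  proof -
    have "(T $ 1) ^ s = (T ^ s) $ s" by (rule startsby_zero_power_nth_same[OF T0, symmetric])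
    also have "\<dots> = - a" unfolding Ts by (simp add: fps_X_power_mult_nth p0)
    finally show ?thesis .
  qed
  have T_nz: "T \<noteq> 0" using T1 a s by (intro fps_order1_nonzero) (auto simp: power_0_left)
  have "fls_compose_fps f T = fps_to_fls (p oo T) * fps_to_fls T powi (- int s)"
    unfolding fp fls_compose_fps_shift[OF T_nz] using T_nz T0 by simp
  also have "\<dots> = fps_to_fls (p oo T) / fps_to_fls (T ^ s)"
    by (simp add: power_int_minus fps_to_fls_power divide_inverse)
  also have "\<dots> = - fls_X_intpow (- int s)"
  proof -
    have "fps_to_fls (T ^ s) * (- fls_X_intpow (- int s)) = fps_to_fls (p oo T)"
      unfolding Ts by (simp add: fls_times_fps_to_fls fps_to_fls_power fls_X_power_conv_shift_1
          fls_shift_1_times fls_X_intpow_times_conv_shift fls_shifted_times_simps)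
    moreover have "fps_to_fls (T ^ s) \<noteq> 0" using T_nz by simp
    ultimately show ?thesis by (metis nonzero_mult_div_cancel_left)
  qed
  finally show thesis using that T0 T1 by blast
qed

theorem theorem1p1:
  fixes s r :: nat and a :: "'k :: {alg_closed_field, field_char_0}" and f :: "'k fls"
  assumes "s > 0" and "r > 0" and "a \<noteq> 0"
    and "R_rel r `` {f} \<in> R_circ r"
    and "\<forall>i \<le> - int s. fls_nth (f - fls_const a * fls_X_intpow (- int s)) i = 0"
  shows "mellin_defined (E_obj r f) \<and>
    (\<exists>g. solves_system s r a f g) \<and>
    (\<forall>g. solves_system s r a f g \<longrightarrow>
      S_rel s `` {g} \<in> S_circ s \<and>
      diff_iso (local_mellin (E_obj r f)) (D_obj s g))"
proof -
  note s = assms(1) and r = assms(2) and a = assms(3) and R = assms(4)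
  have coeff: "f $$ i = (if i = - int s then a else 0)" if "i \<le> - int s" for i
    using assms(5) that by (auto simp: fls_X_intpow_times_conv_shift)
  then have f: "order_ge (- int s) f" "f $$ (- int s) = a"
    by (auto simp: order_ge_def)
  obtain T where T: "T $ 0 = 0" "(T $ 1) ^ s = - a" "fls_compose_fps f T = - fls_X_intpow (- int s)"
    by (rule system_solvable[OF s f a])
  then have ex: "\<exists>g. solves_system s r a f g"
    unfolding solves_system_def by blast
  have main: "S_rel s `` {g} \<in> S_circ s \<and> mellin_defined (E_obj r f)
      \<and> diff_iso (local_mellin (E_obj r f)) (D_obj s g)" if "solves_system s r a f g" for g
  proof -
    obtain T b where T0: "T $ 0 = 0" and T1: "T $ 1 = b" and b: "b ^ s = - a"
      and fT: "fls_compose_fps f T = - fls_X_intpow (- int s)"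
      and g: "g = fps_to_fls (T ^ r) - fls_const (b ^ r * (of_nat (r + s) / of_nat (2 * s))) * fls_X ^ (s + r)"
      using \<open>solves_system s r a f g\<close> unfolding solves_system_def by blast
    have b0: "b \<noteq> 0" using b a s by (auto simp: power_0_left)
    obtain G where G: "exact 0 G"
      "\<And>v. euler_connection r f (G v) = - G (fls_X_intpow (- int s) * v)"
      "\<And>v. fls_X_intpow (int r) * G v = G (g * phi_ext s v)"
      by (rule mellin_model[OF s r T0 T1 b0 g fT]) blast
    show ?thesis
      using S_circ_of_system[OF s r T0 T1 b0 g fT f(1) R] local_mellin_model[OF s r _ G] by blast
  qed
  with ex show ?thesis by blast
qed

end
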